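(* Let $d\ge 2$ be a fixed integer and let $H=\overrightarrow{G}(n,d)$. Then, with probability tending to $1$ as $n\to\infty$ (through $n$ with $nd$ even), $$\overrightarrow{r_1}(H)\le n(\log n)^{4\log d}.$$
   Context: All digraphs are simple and oriented (no loops, parallel or anti-parallel edges). $G(n,d)$ is the uniformly random $d$-regular (simple) graph on vertex set $[n]=\{1,\dots,n\}$, and $\overrightarrow{G}(n,d)$ is the acyclic digraph obtained from it by orienting every edge $\{i,j\}$ with $i<j$ from $i$ to $j$. A copy of $H$ in $T$ is given by an injective map $V(H)\to V(T)$ sending edges of $H$ to edges of $T$ with orientations preserved. For an acyclic digraph $H$, $\overrightarrow{r_1}(H)$ is the least $N$ such that every tournament on $N$ vertices contains a copy of $H$. All logarithms are to base $2$. *)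

theory Defs
  imports "HOL-Probability.Probability" "Graph_Theory.Pair_Digraph"
begin

(* Digraphs are pair digraphs of the AFP entry Graph_Theory: finite vertex set, arcs are ordered
   pairs, no loops (hence no parallel arcs).  As in that entry, an undirected simple graph is a
   symmetric loop-free digraph (pair_graph), the edge {u, v} being the two arcs (u, v), (v, u). *)

definition tournament :: "'a pair_pre_digraph \<Rightarrow> bool" where
  "tournament T \<longleftrightarrow> pair_digraph T \<and>
     (\<forall>u \<in> pverts T. \<forall>v \<in> pverts T. u \<noteq> v \<longrightarrow> ((u, v) \<in> parcs T) \<noteq> ((v, u) \<in> parcs T))"

definition contains_copy :: "'b pair_pre_digraph \<Rightarrow> 'a pair_pre_digraph \<Rightarrow> bool" where
  "contains_copy T H \<longleftrightarrow>
     (\<exists>f. inj_on f (pverts H) \<and> f ` pverts H \<subseteq> pverts T \<and>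
          (\<forall>(u, v) \<in> parcs H. (f u, f v) \<in> parcs T))"

(* Up to isomorphism every finite tournament has its vertices in nat.  The LEAST is meaningful
   for acyclic H, for which such an N exists. *)
definition oriented_ramsey :: "'a pair_pre_digraph \<Rightarrow> nat" where
  "oriented_ramsey H =
     (LEAST N. \<forall>T :: nat pair_pre_digraph. tournament T \<and> card (pverts T) = N \<longrightarrow> contains_copy T H)"

(* In a symmetric digraph, the out-degree of a vertex is its degree as an undirected graph. *)
definition regular_graphs :: "nat \<Rightarrow> nat \<Rightarrow> nat pair_pre_digraph set" where
  "regular_graphs n d =
     {G. pair_graph G \<and> pverts G = {1..n} \<and> (\<forall>v \<in> {1..n}. out_degree (with_proj G) v = d)}"

definition orient_upwards :: "nat pair_pre_digraph \<Rightarrow> nat pair_pre_digraph" where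
  "orient_upwards G = \<lparr> pverts = pverts G, parcs = {(i, j) \<in> parcs G. i < j} \<rparr>"

(* Uniform distribution; unspecified if there is no d-regular graph on {1..n}, that is, for n > 0,
   if n <= d or n * d is odd. *)
definition random_regular_graph :: "nat \<Rightarrow> nat \<Rightarrow> nat pair_pre_digraph pmf" where
  "random_regular_graph n d = pmf_of_set (regular_graphs n d)"

definition random_regular_digraph :: "nat \<Rightarrow> nat \<Rightarrow> nat pair_pre_digraph pmf" where
  "random_regular_digraph n d = map_pmf orient_upwards (random_regular_graph n d)"

end

(*
  The proof gives a linear bound.  Cut [n] into K = K(d) consecutive intervals and call an edge of
  the d-regular graph G inner if both ends lie in the same interval.  A greedy embedding shows that a
  tournament T on at least C(d) n vertices either contains H or contains two sets A, B of linear size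
  with almost all pairs directed from A to B; iterating, T contains H or a chain V_1, ..., V_K of
  linear-sized sets in which every vertex of V_i is joined in the forward direction to all but a
  1/(4d) fraction of every other V_j.

  H is embedded into the chain, its i-th interval into V_i, one component of the inner graph at a
  time.  The components have size at most (log n)/m for a large constant m, so each of them fits into
  a transitive subtournament of any linear-sized set; it remains to order the components such that
  each sends at most d edges to the earlier ones.  An isolated vertex of the inner graph is no
  problem.  The other components have few edges between them because, with high probability, G has
  no tree on (log n)/m vertices half of whose edges are inner, and no connected subgraph on at most
  (log n)/m vertices with more edges than vertices.  Both are first moment computations that need
  only P(F is in G) <= (2d/n)^|F|, which follows by switching: replace the edges uv, xy by ux, vy.
*)
theory Submission
  imports Defs "HOL-Real_Asymp.Real_Asymp"
begin

section \<open>Embedding into tournaments\<close>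

text \<open>Inside one set V_i nothing is known about the tournament, so inner edges can only be
  served by a transitive subtournament, which is guaranteed only at logarithmic size. Between two
  sets each edge to an embedded vertex costs a fixed share of the candidates, so only boundedly many
  are affordable. Hence inner components must be both small and attached by few edges. Why few
  edges: if a connected piece has at most as many edges as vertices, contracting its inner
  components leaves a multigraph of average degree at most 2, so some component sends out at most 2
  \<le> d edges. Choice of constants: the size t is about (log n) / (2 b) with 16 d \<le> 2^b, so
  that (8 d)^t stays below sqrt n and does not eat up the factor 1/n gained from an excess edge.
  Then K = 2^(10 b + 1) makes inner edges so rare that trees of this small size with half their
  edges inner are already unlikely. C is chosen last and depends on K. The stated bound follows
  because d \<ge> 2 gives 4 log d \<ge> 4, and the power of log n outgrows C.\<close>

definition tournament_on :: "'b set \<Rightarrow> 'b rel \<Rightarrow> bool" where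
  "tournament_on V R \<longleftrightarrow> (\<forall>u\<in>V. \<forall>v\<in>V. u \<noteq> v \<longrightarrow> ((u, v) \<in> R) \<noteq> ((v, u) \<in> R))"

definition embeds :: "'a set \<Rightarrow> 'a rel \<Rightarrow> 'b set \<Rightarrow> 'b rel \<Rightarrow> bool" where
  "embeds X E V R \<longleftrightarrow>
     (\<exists>f. inj_on f X \<and> f ` X \<subseteq> V \<and> (\<forall>x\<in>X. \<forall>y\<in>X. (x, y) \<in> E \<longrightarrow> (f x, f y) \<in> R))"

definition nbrs :: "'a rel \<Rightarrow> 'a \<Rightarrow> 'a set" where
  "nbrs E x = {y. (x, y) \<in> E \<or> (y, x) \<in> E}"

lemma tournament_on_subset: "tournament_on V R \<Longrightarrow> W \<subseteq> V \<Longrightarrow> tournament_on W R"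
  unfolding tournament_on_def by blast

lemma embeds_mono: "embeds X E W R \<Longrightarrow> W \<subseteq> V \<Longrightarrow> embeds X E V R"
  unfolding embeds_def by blast

text \<open>Of the at least \<open>2 ^ Suc k - 1\<close> vertices other than v, at least
  \<open>2 ^ k\<close> lie on the same side of v, as out- or as in-neighbours. Accordingly v becomes
  the image of the minimum or of the maximum of C, and the rest goes into that side. All increasing
  pairs of C are served, hence every upward oriented graph on C.\<close>

lemma transitive_subtournament:
  fixes C :: "'a::linorder set"
  assumes "finite C" "tournament_on D R" "finite D" "2 ^ card C \<le> card D"
  shows "embeds C {(x, y). x < y} D R"
  using assms
proof (induction "card C" arbitrary: C D)
  case 0
  then show ?case by (auto simp: embeds_def)
next
  case (Suc k C D)
  have Cne: "C \<noteq> {}" using Suc.hyps(2) by auto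
  have k: "card C = Suc k" using Suc.hyps(2) by simp
  have "card D > 0" using Suc.prems(4) by (metis less_le_trans zero_less_numeral zero_less_power)
  then obtain v where v: "v \<in> D" by fastforce
  define A where "A = {w \<in> D. w \<noteq> v \<and> (v, w) \<in> R}"
  define B where "B = {w \<in> D. w \<noteq> v \<and> (w, v) \<in> R}"
  have AB: "D = insert v (A \<union> B)"
    using v Suc.prems(2) unfolding A_def B_def tournament_on_def by auto
  have fin: "finite A" "finite B" using Suc.prems(3) by (auto simp: A_def B_def)
  have "card D \<le> 1 + (card A + card B)"
    unfolding AB using card_Un_le[of A B] fin
    by (simp add: card_insert_if)
  then have "2 ^ Suc k \<le> 1 + (card A + card B)" using Suc.prems(4) k by simp
  then have "2 ^ k \<le> card A \<or> 2 ^ k \<le> card B" by (simp; linarith)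
  then show ?case
  proof
    assume le: "2 ^ k \<le> card A"
    let ?m = "Min C"
    have m: "?m \<in> C" "\<forall>x\<in>C. ?m \<le> x" using Suc.prems(1) Cne by auto
    have c: "k = card (C - {?m})" using m k Suc.prems(1) by simp
    have "tournament_on A R" using Suc.prems(2) by (rule tournament_on_subset) (auto simp: A_def)
    then have "embeds (C - {?m}) {(x, y). x < y} A R"
      using Suc.hyps(1)[OF c] Suc.prems(1) fin le c by auto
    then obtain f where f: "inj_on f (C - {?m})" "f ` (C - {?m}) \<subseteq> A"
      "\<forall>x\<in>C - {?m}. \<forall>y\<in>C - {?m}. x < y \<longrightarrow> (f x, f y) \<in> R" by (auto simp: embeds_def)
    let ?f = "f(?m := v)"
    have "inj_on ?f C"
      using f(1,2) m(1) unfolding inj_on_def A_def by auto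
    moreover have "?f ` C \<subseteq> D" using f(2) v by (auto simp: A_def)
    moreover have "(?f x, ?f y) \<in> R" if "x \<in> C" "y \<in> C" "x < y" for x y
    proof -
      have ym: "y \<noteq> ?m" using m(2) that leD by blast
      show ?thesis
      proof (cases "x = ?m")
        case True
        have "f y \<in> A" using f(2) ym that by blast
        then show ?thesis using True ym by (simp add: A_def)
      next
        case False
        then show ?thesis using f(3) ym that by simp
      qed
    qed
    ultimately show ?thesis unfolding embeds_def by (intro exI[of _ ?f]) auto
  next
    assume le: "2 ^ k \<le> card B"
    let ?m = "Max C"
    have m: "?m \<in> C" "\<forall>x\<in>C. x \<le> ?m" using Suc.prems(1) Cne by auto
    have c: "k = card (C - {?m})" using m k Suc.prems(1) by simp
    have "tournament_on B R" using Suc.prems(2) by (rule tournament_on_subset) (auto simp: B_def)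
    then have "embeds (C - {?m}) {(x, y). x < y} B R"
      using Suc.hyps(1)[OF c] Suc.prems(1) fin le c by auto
    then obtain f where f: "inj_on f (C - {?m})" "f ` (C - {?m}) \<subseteq> B"
      "\<forall>x\<in>C - {?m}. \<forall>y\<in>C - {?m}. x < y \<longrightarrow> (f x, f y) \<in> R" by (auto simp: embeds_def)
    let ?f = "f(?m := v)"
    have "inj_on ?f C"
      using f(1,2) m(1) unfolding inj_on_def B_def by auto
    moreover have "?f ` C \<subseteq> D" using f(2) v by (auto simp: B_def)
    moreover have "(?f x, ?f y) \<in> R" if "x \<in> C" "y \<in> C" "x < y" for x y
    proof -
      have xm: "x \<noteq> ?m" using m(2) that leD by blast
      show ?thesis
      proof (cases "y = ?m")
        case True
        have "f x \<in> B" using f(2) xm that by blast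
        then show ?thesis using True xm by (simp add: B_def)
      next
        case False
        then show ?thesis using f(3) xm that by simp
      qed
    qed
    ultimately show ?thesis unfolding embeds_def by (intro exI[of _ ?f]) auto
  qed
qed

text \<open>Embed greedily, keeping for every vertex \<open>y\<close> not yet embedded the set of its candidates; each
  embedded neighbour may shrink it by a factor \<open>\<delta>\<close>. If too many choices for the current vertex
  shrink some candidate set too much, then these choices and this set form the pair.\<close>

lemma embeds_or_lopsided_pair:
  fixes E :: "'a::linorder rel" and \<delta> :: real
  assumes X: "finite X" and E: "\<And>x y. (x, y) \<in> E \<Longrightarrow> x < y"
    and deg: "\<forall>x\<in>X. card (nbrs E x \<inter> X) \<le> d"
    and U: "finite U" "tournament_on U R"
    and \<delta>: "0 < \<delta>" "\<delta> \<le> 1"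
    and k1: "2 * real k \<le> \<delta> ^ d * card U"
    and k2: "card X + d * k \<le> \<delta> ^ d * card U"
  shows "embeds X E U R \<or>
    (\<exists>A B. A \<subseteq> U \<and> B \<subseteq> U \<and> k \<le> card A \<and> k \<le> card B \<and>
      ((\<forall>a\<in>A. card {b\<in>B. (a, b) \<notin> R} \<le> 2 * \<delta> * card B) \<or>
       (\<forall>a\<in>A. card {b\<in>B. (b, a) \<notin> R} \<le> 2 * \<delta> * card B)))"
    (is "_ \<or> ?pair")
proof (rule disjCI)
  assume nopair: "\<not> ?pair"
  define C where "C = (\<lambda>f Z y. {v\<in>U. \<forall>x\<in>Z. ((x, y) \<in> E \<longrightarrow> (f x, v) \<in> R) \<and> ((y, x) \<in> E \<longrightarrow> (v, f x) \<in> R)})"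
  have finC: "finite (C f Z y)" and CU: "C f Z y \<subseteq> U" for f Z y using U by (auto simp: C_def)
  have "Z \<subseteq> X \<Longrightarrow> \<exists>f. inj_on f Z \<and> f ` Z \<subseteq> U \<and> (\<forall>x\<in>Z. \<forall>y\<in>Z. (x, y) \<in> E \<longrightarrow> (f x, f y) \<in> R) \<and>
      (\<forall>y\<in>X - Z. \<delta> ^ card (nbrs E y \<inter> Z) * card U \<le> card (C f Z y))" if "finite Z" for Z
    using that
  proof (induction Z rule: finite_induct)
    case empty
    then show ?case by (auto simp: C_def)
  next
    case (insert x Z)
    then obtain f where f: "inj_on f Z" "f ` Z \<subseteq> U" "\<forall>x\<in>Z. \<forall>y\<in>Z. (x, y) \<in> E \<longrightarrow> (f x, f y) \<in> R"
      and Cf: "\<forall>y\<in>X - Z. \<delta> ^ card (nbrs E y \<inter> Z) * card U \<le> card (C f Z y)"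
      by auto
    have xX: "x \<in> X" "Z \<subseteq> X" using insert.prems by auto
    have big: "\<delta> ^ d * card U \<le> card (C f Z y)" if "y \<in> X - Z" for y
    proof -
      have "card (nbrs E y \<inter> Z) \<le> card (nbrs E y \<inter> X)"
        using X xX by (intro card_mono) auto
      also have "\<dots> \<le> d" using deg that by auto
      finally have "\<delta> ^ d \<le> \<delta> ^ card (nbrs E y \<inter> Z)" using \<delta> by (intro power_decreasing) auto
      then show ?thesis using Cf that by (meson mult_right_mono of_nat_0_le_iff order_trans)
    qed
    define good where "good = (\<lambda>a y. {v \<in> C f Z y. ((x, y) \<in> E \<longrightarrow> (a, v) \<in> R) \<and> ((y, x) \<in> E \<longrightarrow> (v, a) \<in> R)})"
    define bad where "bad = (\<lambda>y. {a \<in> C f Z x. card (good a y) < \<delta> * card (C f Z y)})"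
    have bad: "card (bad y) \<le> k" if y: "y \<in> X - insert x Z" "y \<in> nbrs E x" for y
    proof (rule ccontr)
      assume "\<not> card (bad y) \<le> k"
      then obtain A where A: "A \<subseteq> bad y" "card A = k"
        by (meson nle_le obtain_subset_with_card_n)
      have finA: "finite A" by (rule finite_subset[OF A(1)]) (simp add: bad_def finC)
      \<comment> \<open>Removing A costs at most half of the candidates by \<open>k1\<close>. It
        makes A and B disjoint, so that every pair between them is oriented in exactly one
        direction.\<close>
      define B where "B = C f Z y - A"
      have B: "B \<subseteq> U" "A \<inter> B = {}" "finite B" using CU[of f Z y] finC by (auto simp: B_def)
      have AU: "A \<subseteq> U" using A(1) CU[of f Z x] unfolding bad_def by blast
      have cy: "\<delta> ^ d * card U \<le> card (C f Z y)" using big y by auto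
      have "card (C f Z y) - card A \<le> card B" unfolding B_def using finA by (rule diff_card_le_card_Diff)
      then have cB: "card (C f Z y) \<le> 2 * real (card B)" and kB: "k \<le> card B"
        using cy k1 A(2) by linarith+
      have wr: "card {b\<in>B. (if (x, y) \<in> E then (b, a) else (a, b)) \<notin> R} \<le> 2 * \<delta> * card B" if "a \<in> A" for a
      proof -
        have nE: "(x, y) \<in> E \<Longrightarrow> (y, x) \<notin> E" using E[of x y] E[of y x] by auto
        \<comment> \<open>A pair that violates the claimed direction is oriented the way the edge
          between x and y demands, so b is a good candidate for a; a bad a has few of these.\<close>
        have "b \<in> good a y" if b: "b \<in> B" "(if (x, y) \<in> E then (b, a) else (a, b)) \<notin> R" for b
        proof -
          have "b \<in> U" "a \<in> U" "b \<noteq> a" "b \<in> C f Z y" using b(1) B AU \<open>a \<in> A\<close> by (auto simp: B_def)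
          then have "((a, b) \<in> R) \<noteq> ((b, a) \<in> R)" using U(2) unfolding tournament_on_def by blast
          then show ?thesis using b(2) nE y(2) \<open>b \<in> C f Z y\<close>
            unfolding good_def nbrs_def by (auto split: if_splits)
        qed
        then have "{b\<in>B. (if (x, y) \<in> E then (b, a) else (a, b)) \<notin> R} \<subseteq> good a y" by blast
        then have "card {b\<in>B. (if (x, y) \<in> E then (b, a) else (a, b)) \<notin> R} \<le> card (good a y)"
          using finC by (intro card_mono) (auto simp: good_def)
        also have "card (good a y) \<le> \<delta> * card (C f Z y)" using that A by (auto simp: bad_def)
        also have "\<dots> \<le> \<delta> * (2 * card B)" using cB \<delta> by (intro mult_left_mono) auto
        finally show ?thesis by simp
      qed
      have ?pair
        by (rule exI[of _ A], rule exI[of _ B], cases "(x, y) \<in> E")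
           (use AU B A kB wr in auto)
      then show False using nopair by blast
    qed
    define Y where "Y = nbrs E x \<inter> (X - insert x Z)"
    have Y: "finite Y" "card Y \<le> d"
    proof -
      show "finite Y" using X by (simp add: Y_def)
      have "card Y \<le> card (nbrs E x \<inter> X)" unfolding Y_def using X by (intro card_mono) auto
      then show "card Y \<le> d" using deg xX by (meson order_trans)
    qed
    have "card (\<Union>y\<in>Y. bad y) \<le> (\<Sum>y\<in>Y. card (bad y))" using Y(1) by (rule card_UN_le)
    also have "\<dots> \<le> (\<Sum>y\<in>Y. k)" by (intro sum_mono bad) (auto simp: Y_def)
    also have "\<dots> \<le> d * k" using Y by simp
    finally have bads: "card (\<Union>y\<in>Y. bad y) \<le> d * k" .
    \<comment> \<open>Forbidden choices for x: the vertices in use, fewer than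
      \<open>card X\<close>, and at most k bad ones for each of at most d neighbours still to come.
      These are the two terms of \<open>k2\<close>.\<close>
    have "card (f ` Z) \<le> card Z" using insert.hyps by (intro card_image_le)
    also have "card Z < card X" using insert.hyps xX X by (intro psubset_card_mono) auto
    finally have "card (f ` Z \<union> (\<Union>y\<in>Y. bad y)) < card X + d * k"
      using card_Un_le[of "f ` Z" "\<Union>y\<in>Y. bad y"] bads by linarith
    also have "card X + d * k \<le> card (C f Z x)"
    proof -
      have "real (card X + d * k) \<le> real (card (C f Z x))"
        using order_trans[OF k2 big[of x]] xX insert.hyps by simp
      then show ?thesis by (simp only: of_nat_le_iff)
    qed
    finally have "\<not> C f Z x \<subseteq> f ` Z \<union> (\<Union>y\<in>Y. bad y)"
    proof -
      assume lt: "card (f ` Z \<union> (\<Union>y\<in>Y. bad y)) < card (C f Z x)"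
      have "finite (f ` Z \<union> (\<Union>y\<in>Y. bad y))" using insert.hyps Y(1) finC by (auto simp: bad_def)
      then show ?thesis using lt by (metis card_mono leD)
    qed
    then obtain a where a: "a \<in> C f Z x" "a \<notin> f ` Z" "\<And>y. y \<in> Y \<Longrightarrow> a \<notin> bad y" by blast
    let ?f = "f(x := a)"
    have same: "z \<in> Z \<Longrightarrow> ?f z = f z" for z using insert.hyps by auto
    have "inj_on ?f (insert x Z)" using f(1) a(2) insert.hyps(2) by (auto simp: inj_on_def)
    moreover have "?f ` insert x Z \<subseteq> U" using f(2) a(1) CU[of f Z x] by auto
    moreover have "(?f u, ?f v) \<in> R" if "u \<in> insert x Z" "v \<in> insert x Z" "(u, v) \<in> E" for u v
    proof -
      have "u \<noteq> v" using E that by blast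
      then show ?thesis using that f(3) a(1) insert.hyps(2) by (auto simp: C_def)
    qed
    moreover have "\<delta> ^ card (nbrs E y \<inter> insert x Z) * card U \<le> card (C ?f (insert x Z) y)"
      if y: "y \<in> X - insert x Z" for y
    proof -
      have Ceq: "C ?f (insert x Z) y = good a y"
        unfolding C_def good_def using same insert.hyps(2) by auto
      show ?thesis
      proof (cases "y \<in> nbrs E x")
        case True
        then have "a \<notin> bad y" using a(3) y by (auto simp: Y_def)
        then have "\<delta> * card (C f Z y) \<le> card (good a y)" using a(1) by (auto simp: bad_def)
        moreover have "nbrs E y \<inter> insert x Z = insert x (nbrs E y \<inter> Z)" "x \<notin> nbrs E y \<inter> Z"
          using True insert.hyps by (auto simp: nbrs_def)
        then have "card (nbrs E y \<inter> insert x Z) = Suc (card (nbrs E y \<inter> Z))"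
          using insert.hyps by simp
        moreover have "\<delta> * (\<delta> ^ card (nbrs E y \<inter> Z) * card U) \<le> \<delta> * card (C f Z y)"
          using Cf y \<delta> by (intro mult_left_mono) auto
        ultimately show ?thesis unfolding Ceq by (simp add: mult.assoc)
      next
        case False
        then have "good a y = C f Z y" "nbrs E y \<inter> insert x Z = nbrs E y \<inter> Z"
          by (auto simp: good_def nbrs_def)
        then show ?thesis unfolding Ceq using Cf y by auto
      qed
    qed
    ultimately show ?case
      by (intro exI[of _ ?f] conjI ballI impI) blast+
  qed
  from this[OF X subset_refl] show "embeds X E U R" unfolding embeds_def by blast
qed


section \<open>Dominating pairs and chains\<close>

text \<open>Double counting: at most half of B can exceed twice the average number
  \<open>\<epsilon> * card A\<close> of P-pairs. Deleting this half at most doubles the share of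
  P-pairs at each a. P is abstract because the pair may be lopsided in either direction.\<close>

lemma clean_lopsided_pair:
  fixes \<epsilon> :: real
  assumes fin: "finite A" "finite B" and \<epsilon>: "\<epsilon> > 0"
    and few: "\<And>a. a \<in> A \<Longrightarrow> card {b\<in>B. P a b} \<le> \<epsilon> * card B"
  obtains B' where "B' \<subseteq> B" "card B \<le> 2 * card B'"
    "\<And>a. a \<in> A \<Longrightarrow> card {b\<in>B'. P a b} \<le> 2 * \<epsilon> * card B'"
    "\<And>b. b \<in> B' \<Longrightarrow> card {a\<in>A. P a b} \<le> 2 * \<epsilon> * card A"
proof -
  define B0 where "B0 = {b\<in>B. 2 * \<epsilon> * card A < card {a\<in>A. P a b}}"
  have B0: "finite B0" "B0 \<subseteq> B" using fin by (auto simp: B0_def)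
  have "2 * card B0 \<le> card B"
  proof (cases "A = {}")
    case True
    then show ?thesis by (simp add: B0_def)
  next
    case False
    then have A: "card A > 0" using fin by (simp add: card_gt_0_iff)
    have "card B0 * (2 * \<epsilon> * card A) = (\<Sum>b\<in>B0. 2 * \<epsilon> * card A)" by simp
    also have "\<dots> \<le> (\<Sum>b\<in>B0. real (card {a\<in>A. P a b}))"
      by (intro sum_mono) (auto simp: B0_def)
    also have "\<dots> \<le> (\<Sum>b\<in>B. real (card {a\<in>A. P a b}))"
      using B0 fin by (intro sum_mono2) auto
    also have "\<dots> = (\<Sum>b\<in>B. \<Sum>a\<in>A. if P a b then 1 else 0)"
      using fin by (intro sum.cong refl) (simp add: sum.If_cases Int_def)
    also have "\<dots> = (\<Sum>a\<in>A. \<Sum>b\<in>B. if P a b then 1 else 0)" by (rule sum.swap)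
    also have "\<dots> = (\<Sum>a\<in>A. real (card {b\<in>B. P a b}))"
      using fin by (intro sum.cong refl) (simp add: sum.If_cases Int_def)
    also have "\<dots> \<le> (\<Sum>a\<in>A. \<epsilon> * card B)" by (intro sum_mono few)
    finally have "(2 * card B0) * (\<epsilon> * card A) \<le> card B * (\<epsilon> * card A)"
      by (simp add: algebra_simps)
    moreover have "\<epsilon> * card A > 0" using A \<epsilon> by simp
    ultimately have "real (2 * card B0) \<le> real (card B)"
      by (metis mult_le_cancel_right_pos)
    then show ?thesis by linarith
  qed
  then have c: "card B \<le> 2 * card (B - B0)"
    using B0 by (simp add: card_Diff_subset)
  show thesis
  proof (rule that[of "B - B0"])
    fix a assume a: "a \<in> A"
    have "card {b \<in> B - B0. P a b} \<le> card {b\<in>B. P a b}" using fin by (intro card_mono) auto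
    also have "card {b\<in>B. P a b} \<le> \<epsilon> * card B" using few a .
    also have "\<dots> \<le> \<epsilon> * (2 * card (B - B0))" using c \<epsilon> by (intro mult_left_mono) linarith+
    finally show "card {b \<in> B - B0. P a b} \<le> 2 * \<epsilon> * card (B - B0)" by simp
  qed (use c in \<open>auto simp: B0_def\<close>)
qed

text \<open>Both sides are controlled because a component placed into one set may have embedded
  neighbours in earlier as well as in later sets of the chain.\<close>

definition dominates :: "'b rel \<Rightarrow> real \<Rightarrow> 'b set \<Rightarrow> 'b set \<Rightarrow> bool" where
  "dominates R \<eta> A B \<longleftrightarrow> (\<forall>a\<in>A. card {b\<in>B. (a, b) \<notin> R} \<le> \<eta> * real (card B)) \<and>
     (\<forall>b\<in>B. card {a\<in>A. (a, b) \<notin> R} \<le> \<eta> * real (card A))"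

text \<open>The number of missing pairs at a vertex cannot grow in a subset; only its share can, by
  the factor by which the set shrinks.\<close>

lemma dominates_subset:
  fixes \<eta> \<delta> :: real
  assumes "dominates R \<delta> A B" "A' \<subseteq> A" "B' \<subseteq> B" "finite A" "finite B" "0 \<le> \<delta>"
    "\<delta> * card A \<le> \<eta> * card A'" "\<delta> * card B \<le> \<eta> * card B'"
  shows "dominates R \<eta> A' B'"
proof -
  have "card {b\<in>B'. (a, b) \<notin> R} \<le> \<eta> * card B'" if "a \<in> A'" for a
  proof -
    have "card {b\<in>B'. (a, b) \<notin> R} \<le> card {b\<in>B. (a, b) \<notin> R}" using assms by (intro card_mono) auto
    also have "card {b\<in>B. (a, b) \<notin> R} \<le> \<delta> * card B" using assms that by (auto simp: dominates_def)
    finally show ?thesis using assms(8) by simp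
  qed
  moreover have "card {a\<in>A'. (a, b) \<notin> R} \<le> \<eta> * card A'" if "b \<in> B'" for b
  proof -
    have "card {a\<in>A'. (a, b) \<notin> R} \<le> card {a\<in>A. (a, b) \<notin> R}" using assms by (intro card_mono) auto
    also have "card {a\<in>A. (a, b) \<notin> R} \<le> \<delta> * card A" using assms that by (auto simp: dominates_def)
    finally show ?thesis using assms(7) by simp
  qed
  ultimately show ?thesis by (auto simp: dominates_def)
qed

definition host :: "nat \<Rightarrow> real \<Rightarrow> 'a::linorder set \<Rightarrow> 'a rel \<Rightarrow> 'b set \<Rightarrow> 'b rel \<Rightarrow> bool" where
  "host d C X E U R \<longleftrightarrow> finite X \<and> (\<forall>x y. (x, y) \<in> E \<longrightarrow> x < y) \<and>
     (\<forall>x\<in>X. card (nbrs E x \<inter> X) \<le> d) \<and> finite U \<and> tournament_on U R \<and> C * real (card X) \<le> real (card U)"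

lemma embeds_or_dominating_pair:
  fixes \<delta> :: real
  assumes "\<delta> > 0"
  obtains c C :: real where "c > 0" "C > 0"
    "\<And>(X :: 'a::linorder set) E (U :: 'b set) R. host d C X E U R \<Longrightarrow> \<not> embeds X E U R \<Longrightarrow>
       \<exists>A B. A \<subseteq> U \<and> B \<subseteq> U \<and> c * card U \<le> card A \<and> c * card U \<le> card B \<and> dominates R \<delta> A B"
proof -
  \<comment> \<open>The lopsided pair comes with the share \<open>2 * e\<close>, and cleaning
    doubles it; hence a quarter of \<delta>.\<close>
  define e where "e = min \<delta> 1 / 4"
  have e: "0 < e" "e \<le> 1" "4 * e \<le> \<delta>" using assms by (auto simp: e_def)
  \<comment> \<open>With k about \<open>c * card U\<close>, both k and \<open>d * k\<close> are at
    most half of \<open>e ^ d * card U\<close>, as the greedy embedding requires.\<close>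
  define c where "c = e ^ d / (2 * (real d + 1))"
  have ed: "e ^ d > 0" using e by simp
  have c: "c > 0" "2 * c \<le> e ^ d" "2 * (d * c) \<le> e ^ d"
    using ed by (auto simp: c_def field_simps)
  \<comment> \<open>The constant \<open>2 / c\<close> forces \<open>c * card U \<ge> 2\<close> for
    nonempty X, so rounding down to k loses at most a factor 2. Cleaning loses another one, whence
    \<open>c / 4\<close>.\<close>
  show thesis
  proof (rule that[of "c / 4" "2 / c"])
    show "c / 4 > 0" "2 / c > 0" using c by auto
    fix X :: "'a set" and E and U :: "'b set" and R
    assume h: "host d (2 / c) X E U R" and ne: "\<not> embeds X E U R"
    have fin: "finite X" "finite U" using h by (auto simp: host_def)
    have "X \<noteq> {}" using ne by (auto simp: embeds_def)
    then have X: "1 \<le> real (card X)" using fin by (simp add: Suc_leI card_gt_0_iff)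
    have XU: "2 * card X \<le> c * card U" using h c by (simp add: host_def field_simps)
    define k where "k = nat \<lfloor>c * card U\<rfloor>"
    have k: "real k \<le> c * card U" "c * card U - 1 \<le> real k"
      unfolding k_def using c XU X by linarith+
    have k': "c * card U \<le> 2 * real k" using k XU X by linarith
    have "2 * real k \<le> 2 * (c * card U)" using k by simp
    also have "\<dots> \<le> e ^ d * card U" using mult_right_mono[OF c(2), of "card U"] by simp
    finally have k1: "2 * real k \<le> e ^ d * card U" .
    have "d * real k \<le> d * (c * card U)" using k by (intro mult_left_mono) auto
    moreover have "2 * (d * (c * card U)) \<le> e ^ d * card U"
      using mult_right_mono[OF c(3), of "card U"] by (simp add: mult_ac)
    moreover have "2 * (c * card U) \<le> e ^ d * card U"
      using mult_right_mono[OF c(2), of "card U"] by simp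
    ultimately have k2: "card X + d * k \<le> e ^ d * card U" using XU by simp
    have "\<exists>A B. A \<subseteq> U \<and> B \<subseteq> U \<and> k \<le> card A \<and> k \<le> card B \<and>
      ((\<forall>a\<in>A. card {b\<in>B. (a, b) \<notin> R} \<le> 2 * e * card B) \<or>
       (\<forall>a\<in>A. card {b\<in>B. (b, a) \<notin> R} \<le> 2 * e * card B))"
      using embeds_or_lopsided_pair[of X E d U R e k] h ne e k1 k2 unfolding host_def by blast
    then obtain A B where AB: "A \<subseteq> U" "B \<subseteq> U" "k \<le> card A" "k \<le> card B"
      and or: "(\<forall>a\<in>A. card {b\<in>B. (a, b) \<notin> R} \<le> 2 * e * card B) \<or>
       (\<forall>a\<in>A. card {b\<in>B. (b, a) \<notin> R} \<le> 2 * e * card B)" by blast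
    have finAB: "finite A" "finite B" using AB fin finite_subset by auto
    have up: "2 * (2 * e) * real m \<le> \<delta> * real m" for m using e by (intro mult_right_mono) auto
    have size: "c / 4 * card U \<le> card D" if "k \<le> 2 * card D" for D :: "'b set"
    proof -
      have "real k \<le> 2 * real (card D)" using that by linarith
      then show ?thesis using k' by linarith
    qed
    from or show "\<exists>A B. A \<subseteq> U \<and> B \<subseteq> U \<and> c / 4 * card U \<le> card A \<and> c / 4 * card U \<le> card B \<and> dominates R \<delta> A B"
    proof
      assume *: "\<forall>a\<in>A. card {b\<in>B. (a, b) \<notin> R} \<le> 2 * e * card B"
      obtain B' where B': "B' \<subseteq> B" "card B \<le> 2 * card B'"
        "\<And>a. a \<in> A \<Longrightarrow> card {b\<in>B'. (a, b) \<notin> R} \<le> 2 * (2 * e) * card B'"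
        "\<And>b. b \<in> B' \<Longrightarrow> card {a\<in>A. (a, b) \<notin> R} \<le> 2 * (2 * e) * card A"
        using clean_lopsided_pair[OF finAB, of "2 * e" "\<lambda>a b. (a, b) \<notin> R"] * e by auto
      have "dominates R \<delta> A B'" unfolding dominates_def
        using B'(3,4) up by (meson order_trans)
      moreover have "c / 4 * card U \<le> card A" "c / 4 * card U \<le> card B'"
        by (rule size; use AB B' in linarith)+
      ultimately show ?thesis using AB B'(1) by blast
    next
      assume *: "\<forall>a\<in>A. card {b\<in>B. (b, a) \<notin> R} \<le> 2 * e * card B"
      obtain B' where B': "B' \<subseteq> B" "card B \<le> 2 * card B'"
        "\<And>a. a \<in> A \<Longrightarrow> card {b\<in>B'. (b, a) \<notin> R} \<le> 2 * (2 * e) * card B'"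
        "\<And>b. b \<in> B' \<Longrightarrow> card {a\<in>A. (b, a) \<notin> R} \<le> 2 * (2 * e) * card A"
        using clean_lopsided_pair[OF finAB, of "2 * e" "\<lambda>a b. (b, a) \<notin> R"] * e by auto
      have "dominates R \<delta> B' A" unfolding dominates_def
        using B'(3,4) up by (meson order_trans)
      moreover have "c / 4 * card U \<le> card A" "c / 4 * card U \<le> card B'"
        by (rule size; use AB B' in linarith)+
      ultimately show ?thesis using AB B'(1) by blast
    qed
  qed
qed

text \<open>The length doubles in each round: a graph that does not embed into U embeds into neither
  half of a dominating pair, so both halves contain chains, which are put one after the
  other.\<close>

lemma embeds_or_dominating_chain:
  fixes \<eta> :: real
  assumes "\<eta> > 0"
  shows "\<exists>(c::real)>0. \<exists>C>0. \<forall>(X :: 'a::linorder set) E (U :: 'b set) R. host d C X E U R \<longrightarrow> \<not> embeds X E U R \<longrightarrow>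
    (\<exists>V :: nat \<Rightarrow> 'b set. (\<forall>i<2 ^ l. V i \<subseteq> U \<and> c * card U \<le> card (V i)) \<and>
         (\<forall>j<2 ^ l. \<forall>i<j. dominates R \<eta> (V i) (V j)))"
proof (induction l)
  case 0
  have "\<exists>V :: nat \<Rightarrow> 'b set. (\<forall>i<2 ^ 0. V i \<subseteq> U \<and> (1::real) * card U \<le> card (V i)) \<and>
         (\<forall>j<2 ^ 0. \<forall>i<j. dominates R \<eta> (V i) (V j))" for U :: "'b set" and R
    by (rule exI[of _ "\<lambda>_. U"]) auto
  then show ?case by (intro exI[of _ "1::real"] conjI allI impI zero_less_one)
next
  case (Suc l)
  then obtain c1 C1 :: real where c1: "c1 > 0" and C1: "C1 > 0" and IH: "\<And>(X :: 'a set) E (U :: 'b set) R. host d C1 X E U R \<Longrightarrow> \<not> embeds X E U R \<Longrightarrow>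
    (\<exists>V :: nat \<Rightarrow> 'b set. (\<forall>i<2 ^ l. V i \<subseteq> U \<and> c1 * card U \<le> card (V i)) \<and>
         (\<forall>j<2 ^ l. \<forall>i<j. dominates R \<eta> (V i) (V j)))" by blast
  \<comment> \<open>The pair has to dominate more strictly by the factor \<open>c1\<close>, since
    the sets of the two chains may fill only a \<open>c1\<close> share of its halves.\<close>
  have \<delta>: "\<eta> * c1 > 0" using c1 assms by simp
  obtain c0 C0 :: real where c0: "c0 > 0" and C0: "C0 > 0" and pair:
    "\<And>(X :: 'a set) E (U :: 'b set) R. host d C0 X E U R \<Longrightarrow> \<not> embeds X E U R \<Longrightarrow>
       \<exists>A B. A \<subseteq> U \<and> B \<subseteq> U \<and> c0 * card U \<le> card A \<and> c0 * card U \<le> card B \<and> dominates R (\<eta> * c1) A B"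
    by (rule embeds_or_dominating_pair[OF \<delta>, where d = d]) blast
  show ?case
  proof (rule exI[of _ "c1 * c0"], rule conjI[OF _ exI[of _ "max C0 (C1 / c0)"]], goal_cases)
    case 1
    show ?case using c0 c1 by simp
  next
    case 2
    show ?case
    proof (intro conjI allI impI)
      show "max C0 (C1 / c0) > 0" using c0 c1 C0 by auto
      fix X :: "'a set" and E and U :: "'b set" and R
      assume h: "host d (max C0 (C1 / c0)) X E U R" and ne: "\<not> embeds X E U R"
      have "C0 * card X \<le> max C0 (C1 / c0) * card X" "C1 / c0 * card X \<le> max C0 (C1 / c0) * card X"
        by (intro mult_right_mono; simp)+
      moreover have "max C0 (C1 / c0) * card X \<le> card U" using h by (simp add: host_def)
      ultimately have "C0 * card X \<le> card U" and "C1 / c0 * card X \<le> card U"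
        by (meson order_trans)+
      then have hC: "host d C0 X E U R" "C1 * card X \<le> c0 * card U"
        using h c0 by (auto simp: host_def field_simps)
      have finU: "finite U" using h by (simp add: host_def)
      obtain A B where AB: "A \<subseteq> U" "B \<subseteq> U" "c0 * card U \<le> card A" "c0 * card U \<le> card B"
        "dominates R (\<eta> * c1) A B" using pair[OF hC(1) ne] by blast
      have finAB: "finite A" "finite B" using AB finU finite_subset by auto
      have hD: "host d C1 X E D R" "\<not> embeds X E D R" if "D \<subseteq> U" "c0 * card U \<le> card D" for D
      proof -
        have "C1 * card X \<le> card D" using hC(2) that(2) by linarith
        then show "host d C1 X E D R"
          using h tournament_on_subset[of U R D] that(1) finite_subset[OF that(1) finU]
          by (simp add: host_def)
        show "\<not> embeds X E D R" using ne embeds_mono[OF _ that(1)] by blast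
      qed
      obtain V :: "nat \<Rightarrow> 'b set" where V: "\<forall>i<2 ^ l. V i \<subseteq> A \<and> c1 * card A \<le> card (V i)"
        "\<forall>j<2 ^ l. \<forall>i<j. dominates R \<eta> (V i) (V j)"
        using IH[OF hD[OF AB(1,3)]] by (elim exE conjE)
      obtain W :: "nat \<Rightarrow> 'b set" where W: "\<forall>i<2 ^ l. W i \<subseteq> B \<and> c1 * card B \<le> card (W i)"
        "\<forall>j<2 ^ l. \<forall>i<j. dominates R \<eta> (W i) (W j)"
        using IH[OF hD[OF AB(2,4)]] by (elim exE conjE)
      have VW: "dominates R \<eta> (V i) (W j)" if "i < 2 ^ l" "j < 2 ^ l" for i j
      proof (rule dominates_subset[OF AB(5)])
        show "V i \<subseteq> A" "W j \<subseteq> B" "finite A" "finite B" "0 \<le> \<eta> * c1"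
          using V W that finAB \<delta> by auto
        show "\<eta> * c1 * card A \<le> \<eta> * card (V i)" "\<eta> * c1 * card B \<le> \<eta> * card (W j)"
          using V(1) W(1) that assms by auto
      qed
      let ?V = "\<lambda>i. if i < 2 ^ l then V i else W (i - 2 ^ l)"
      have scale: "c1 * c0 * card U \<le> real m" if "c0 * card U \<le> card D" "c1 * card D \<le> m"
        for D :: "'b set" and m :: nat
        using order_trans[OF mult_left_mono[OF that(1), of c1] that(2)] c1 by (simp add: mult.assoc)
      show "\<exists>V :: nat \<Rightarrow> 'b set. (\<forall>i<2 ^ Suc l. V i \<subseteq> U \<and> c1 * c0 * card U \<le> card (V i)) \<and>
           (\<forall>j<2 ^ Suc l. \<forall>i<j. dominates R \<eta> (V i) (V j))"
      proof (intro exI[of _ ?V] conjI allI impI)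
        fix i :: nat assume i: "i < 2 ^ Suc l"
        have "i - 2 ^ l < 2 ^ l" using i by auto
        then have "?V i \<subseteq> A \<or> ?V i \<subseteq> B" using V(1) W(1) by simp
        then show "?V i \<subseteq> U" using AB(1,2) by blast
        have "i - 2 ^ l < 2 ^ l" using i by auto
        then show "c1 * c0 * card U \<le> card (?V i)"
          using V(1) W(1) \<open>i - 2 ^ l < 2 ^ l\<close> scale[OF AB(3), of "card (V i)"]
            scale[OF AB(4), of "card (W (i - 2 ^ l))"] by (cases "i < 2 ^ l") auto
      next
        fix j i :: nat assume ij: "j < 2 ^ Suc l" "i < j"
        have j: "j - 2 ^ l < 2 ^ l" using ij by auto
        consider "j < 2 ^ l" | "i < 2 ^ l" "2 ^ l \<le> j" | "2 ^ l \<le> i" by linarith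
        then show "dominates R \<eta> (?V i) (?V j)"
        proof cases
          case 1
          then show ?thesis using V(2) ij by simp
        next
          case 2
          then show ?thesis using VW j by simp
        next
          case 3
          then have "i - 2 ^ l < j - 2 ^ l" using ij by linarith
          then show ?thesis using W(2) j 3 ij by simp
        qed
      qed
    qed
  qed
qed

section \<open>Embedding into a chain by peeling off components\<close>

definition inner_closed :: "'a set \<Rightarrow> 'a rel \<Rightarrow> ('a \<Rightarrow> nat) \<Rightarrow> 'a set \<Rightarrow> bool" where
  "inner_closed X E \<pi> Y \<longleftrightarrow> (\<forall>x\<in>Y. \<forall>y\<in>X. y \<in> nbrs E x \<longrightarrow> \<pi> x = \<pi> y \<longrightarrow> y \<in> Y)"

text \<open>An elimination order without naming one: removing such sets C one after another empties
  X, and in the reverse order each C has at most d edges to what is already embedded. Here \<pi> is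
  the number of the interval, and inner-closed sets are the unions of components of the inner
  graph.\<close>

definition peelable :: "nat \<Rightarrow> nat \<Rightarrow> 'a set \<Rightarrow> 'a rel \<Rightarrow> ('a \<Rightarrow> nat) \<Rightarrow> bool" where
  "peelable d t X E \<pi> \<longleftrightarrow>
     (\<forall>Y\<subseteq>X. Y \<noteq> {} \<longrightarrow> inner_closed X E \<pi> Y \<longrightarrow>
       (\<exists>C\<subseteq>Y. C \<noteq> {} \<and> inner_closed X E \<pi> C \<and> (\<exists>j. \<forall>x\<in>C. \<pi> x = j) \<and> card C \<le> t \<and>
          card {(x, y). x \<in> C \<and> y \<in> Y - C \<and> y \<in> nbrs E x} \<le> d))"

text \<open>Induction over inner-closed sets Y: embed Y - C first, then C into its set of the chain.
  Of that set at most \<open>card X\<close> vertices are occupied and at most d times a share \<eta>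
  is excluded by the edges leaving C; the \<open>2 ^ t\<close> remaining vertices contain a
  transitive subtournament on \<open>card C\<close> vertices, which serves all edges inside
  C.\<close>

lemma embeds_into_chain:
  fixes X :: "'a::linorder set" and V :: "nat \<Rightarrow> 'b set" and \<eta> :: real
  assumes X: "finite X" and E: "\<And>x y. (x, y) \<in> E \<Longrightarrow> x < y"
    and \<pi>: "\<And>x y. (x, y) \<in> E \<Longrightarrow> \<pi> x \<le> \<pi> y" "\<And>x. x \<in> X \<Longrightarrow> \<pi> x < K"
    and peel: "peelable d t X E \<pi>"
    and U: "finite U" "tournament_on U R"
    and V: "\<And>i. i < K \<Longrightarrow> V i \<subseteq> U"
    and dom: "\<And>i j. j < K \<Longrightarrow> i < j \<Longrightarrow> dominates R \<eta> (V i) (V j)"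
    and \<eta>: "\<eta> \<ge> 0"
    and size: "\<And>i. i < K \<Longrightarrow> real (card X) + 2 ^ t + d * (\<eta> * card (V i)) \<le> card (V i)"
  shows "embeds X E U R"
proof -
  have "\<exists>f. inj_on f Y \<and> (\<forall>x\<in>Y. f x \<in> V (\<pi> x)) \<and> (\<forall>x\<in>Y. \<forall>y\<in>Y. (x, y) \<in> E \<longrightarrow> (f x, f y) \<in> R)"
    if "Y \<subseteq> X" "inner_closed X E \<pi> Y" for Y
    using that
  proof (induction "card Y" arbitrary: Y rule: less_induct)
    case less
    show ?case
    proof (cases "Y = {}")
      case True
      then show ?thesis by auto
    next
      case False
      then obtain C j where C: "C \<subseteq> Y" "C \<noteq> {}" "inner_closed X E \<pi> C" "\<And>x. x \<in> C \<Longrightarrow> \<pi> x = j"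
        "card C \<le> t" and P: "card {(x, y). x \<in> C \<and> y \<in> Y - C \<and> y \<in> nbrs E x} \<le> d"
        using peel less.prems unfolding peelable_def by meson
      define P where "P = {(x, y). x \<in> C \<and> y \<in> Y - C \<and> y \<in> nbrs E x}"
      have finY: "finite Y" using X less.prems finite_subset by blast
      have finC: "finite C" using C(1) finY finite_subset by blast
      have "P \<subseteq> C \<times> Y" by (auto simp: P_def)
      then have finP: "finite P" using finC finY finite_subset by blast
      have "card (Y - C) < card Y" using C(1,2) finY by (intro psubset_card_mono) auto
      moreover have "inner_closed X E \<pi> (Y - C)"
        unfolding inner_closed_def
      proof (intro ballI impI)
        fix x y assume xy: "x \<in> Y - C" "y \<in> X" "y \<in> nbrs E x" "\<pi> x = \<pi> y"
        have "y \<in> Y" using xy less.prems(2) unfolding inner_closed_def by blast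
        moreover have "y \<notin> C"
        proof
          assume "y \<in> C"
          moreover have "x \<in> nbrs E y" "x \<in> X" using xy less.prems(1) by (auto simp: nbrs_def)
          ultimately have "x \<in> C" using C(3) xy(4) unfolding inner_closed_def by metis
          then show False using xy by blast
        qed
        ultimately show "y \<in> Y - C" by blast
      qed
      ultimately obtain f where f: "inj_on f (Y - C)" "\<And>x. x \<in> Y - C \<Longrightarrow> f x \<in> V (\<pi> x)"
        "\<And>x y. x \<in> Y - C \<Longrightarrow> y \<in> Y - C \<Longrightarrow> (x, y) \<in> E \<Longrightarrow> (f x, f y) \<in> R"
        using less.hyps[of "Y - C"] less.prems(1) by blast
      have jK: "j < K" using C \<pi>(2) less.prems(1) by blast
      have finV: "finite (V j)" using V[OF jK] U(1) finite_subset by blast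
      define wrong where "wrong = (\<lambda>(x, y). {v\<in>V j. ((y, x) \<in> E \<and> (f y, v) \<notin> R) \<or> ((x, y) \<in> E \<and> (v, f y) \<notin> R)})"
      have wrong: "card (wrong p) \<le> \<eta> * card (V j)" if p: "p \<in> P" for p
      proof -
        obtain x y where xy: "p = (x, y)" "x \<in> C" "y \<in> Y - C" "y \<in> nbrs E x"
          using p by (auto simp: P_def)
        have yX: "y \<in> X" using xy less.prems by blast
        \<comment> \<open>C is closed under inner edges, so a neighbour outside C lives in another
          set of the chain, where domination applies.\<close>
        have ne: "\<pi> y \<noteq> j" using xy C(3) C(4)[of x] yX unfolding inner_closed_def by (metis DiffD2)
        have fy: "f y \<in> V (\<pi> y)" using f(2) xy by blast
        show ?thesis
        proof (cases "(x, y) \<in> E")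
          case True
          then have "j < \<pi> y" using \<pi>(1)[OF True] C(4)[OF xy(2)] ne by simp
          then have "card {v\<in>V j. (v, f y) \<notin> R} \<le> \<eta> * card (V j)"
            using dom[of "\<pi> y" j] \<pi>(2)[OF yX] fy by (auto simp: dominates_def)
          moreover have "wrong p = {v\<in>V j. (v, f y) \<notin> R}"
            using True E[OF True] E[of y x] by (auto simp: wrong_def xy(1))
          ultimately show ?thesis by simp
        next
          case False
          then have yx: "(y, x) \<in> E" using xy(4) by (auto simp: nbrs_def)
          then have "\<pi> y < j" using \<pi>(1)[OF yx] C(4)[OF xy(2)] ne by simp
          then have "card {v\<in>V j. (f y, v) \<notin> R} \<le> \<eta> * card (V j)"
            using dom[of j "\<pi> y"] jK fy by (auto simp: dominates_def)
          moreover have "wrong p = {v\<in>V j. (f y, v) \<notin> R}"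
            using False yx by (auto simp: wrong_def xy(1))
          ultimately show ?thesis by simp
        qed
      qed
      define D where "D = V j - (f ` (Y - C) \<union> (\<Union>p\<in>P. wrong p))"
      have "real (card (\<Union>p\<in>P. wrong p)) \<le> (\<Sum>p\<in>P. real (card (wrong p)))"
        using card_UN_le[OF finP, of wrong] by (metis of_nat_le_iff of_nat_sum)
      also have "\<dots> \<le> (\<Sum>p\<in>P. \<eta> * card (V j))" by (intro sum_mono wrong)
      also have "\<dots> = card P * (\<eta> * card (V j))" by simp
      also have "\<dots> \<le> d * (\<eta> * card (V j))" using P \<eta> by (intro mult_right_mono) (auto simp: P_def)
      finally have w: "card (\<Union>p\<in>P. wrong p) \<le> d * (\<eta> * card (V j))" .
      have "card (f ` (Y - C)) \<le> card (Y - C)" using finY by (intro card_image_le) auto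
      also have "\<dots> \<le> card X" using X less.prems by (intro card_mono) auto
      finally have fC: "card (f ` (Y - C)) \<le> card X" .
      have finB: "finite (f ` (Y - C) \<union> (\<Union>p\<in>P. wrong p))" using finY finP finV by (auto simp: wrong_def)
      have "card (V j) - card (f ` (Y - C) \<union> (\<Union>p\<in>P. wrong p)) \<le> card D"
        unfolding D_def using finB by (rule diff_card_le_card_Diff)
      then have "card (V j) \<le> card D + (card (f ` (Y - C)) + card (\<Union>p\<in>P. wrong p))"
        using card_Un_le[of "f ` (Y - C)" "\<Union>p\<in>P. wrong p"] by linarith
      then have "real (card (V j)) \<le> card D + (card (f ` (Y - C)) + real (card (\<Union>p\<in>P. wrong p)))"
        by linarith
      then have "2 ^ t \<le> real (card D)" using w fC size[OF jK] by linarith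
      then have "2 ^ t \<le> card D" by (metis of_nat_le_iff of_nat_numeral of_nat_power)
      moreover have "(2::nat) ^ card C \<le> 2 ^ t" using C(5) by (intro power_increasing) auto
      ultimately have cD: "2 ^ card C \<le> card D" by linarith
      have "D \<subseteq> U" "finite D" using V[OF jK] finV by (auto simp: D_def)
      then obtain g where g: "inj_on g C" "g ` C \<subseteq> D" "\<And>x y. x \<in> C \<Longrightarrow> y \<in> C \<Longrightarrow> x < y \<Longrightarrow> (g x, g y) \<in> R"
        using transitive_subtournament[OF finC tournament_on_subset[OF U(2)] _ cD]
        unfolding embeds_def by auto
      define h where "h = (\<lambda>x. if x \<in> C then g x else f x)"
      have Y: "Y = C \<union> (Y - C)" using C(1) by blast
      have hC: "inj_on h C" "h ` C \<subseteq> D"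
        using g by (auto simp: h_def inj_on_def)
      have hD: "inj_on h (Y - C)" "h ` (Y - C) = f ` (Y - C)"
        using f(1) by (auto simp: h_def inj_on_def)
      have "inj_on h Y"
        by (subst Y, subst inj_on_Un) (use hC hD in \<open>auto simp: D_def\<close>)
      moreover have "h x \<in> V (\<pi> x)" if "x \<in> Y" for x
        using f(2)[of x] g(2) C(4)[of x] that by (auto simp: h_def D_def)
      moreover have "(h x, h y) \<in> R" if xy: "x \<in> Y" "y \<in> Y" "(x, y) \<in> E" for x y
      proof -
        consider "x \<in> C" "y \<in> C" | "x \<in> C" "y \<notin> C" | "x \<notin> C" "y \<in> C" | "x \<notin> C" "y \<notin> C" by blast
        then show ?thesis
        proof cases
          case 1
          then show ?thesis using g(3) E xy by (simp add: h_def)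
        next
          case 2
          then have "(x, y) \<in> P" using xy by (auto simp: P_def nbrs_def)
          moreover have "g x \<in> D" using g(2) 2 by blast
          ultimately show ?thesis using 2 xy by (auto simp: D_def wrong_def h_def)
        next
          case 3
          then have "(y, x) \<in> P" using xy by (auto simp: P_def nbrs_def)
          moreover have "g y \<in> D" using g(2) 3 by blast
          ultimately show ?thesis using 3 xy by (auto simp: D_def wrong_def h_def)
        next
          case 4
          then show ?thesis using f(3) xy by (simp add: h_def)
        qed
      qed
      ultimately show ?thesis by blast
    qed
  qed
  from this[of X] obtain f where "inj_on f X" "\<forall>x\<in>X. f x \<in> V (\<pi> x)"
    "\<forall>x\<in>X. \<forall>y\<in>X. (x, y) \<in> E \<longrightarrow> (f x, f y) \<in> R"
    by (auto simp: inner_closed_def)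
  moreover have "V (\<pi> x) \<subseteq> U" if "x \<in> X" for x using V \<pi>(2) that by blast
  ultimately show ?thesis unfolding embeds_def by blast
qed

section \<open>Sparse graphs\<close>

text \<open>Connectedness by cuts: the arc leaving a vertex set is exactly what is needed to grow a
  tree by one vertex.\<close>

definition connected_rel :: "'a rel \<Rightarrow> 'a set \<Rightarrow> bool" where
  "connected_rel G X \<longleftrightarrow> (\<forall>S\<subseteq>X. S \<noteq> {} \<longrightarrow> S \<noteq> X \<longrightarrow> (\<exists>x\<in>S. \<exists>y\<in>X - S. (x, y) \<in> G))"

lemma connected_relD:
  assumes "connected_rel G X" "S \<subseteq> X" "S \<noteq> {}" "S \<noteq> X"
  obtains x y where "x \<in> S" "y \<in> X - S" "(x, y) \<in> G"
  using assms unfolding connected_rel_def by meson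

lemma connected_rel_mono: "connected_rel G X \<Longrightarrow> G \<subseteq> H \<Longrightarrow> connected_rel H X"
  unfolding connected_rel_def by blast

lemma connected_rel_rtrancl:
  assumes "sym G"
  shows "connected_rel G (G\<^sup>* `` {a})"
  unfolding connected_rel_def
proof (intro allI impI)
  fix S assume S: "S \<subseteq> G\<^sup>* `` {a}" "S \<noteq> {}" "S \<noteq> G\<^sup>* `` {a}"
  show "\<exists>x\<in>S. \<exists>y\<in>G\<^sup>* `` {a} - S. (x, y) \<in> G"
  proof (rule ccontr)
    assume no: "\<not> ?thesis"
    have "(x, y) \<in> G \<Longrightarrow> (y, x) \<in> G" for x y using assms by (auto dest: symD)
    then have cut: "y \<in> S \<longleftrightarrow> x \<in> S" if "(a, x) \<in> G\<^sup>*" "(x, y) \<in> G" for x y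
    proof -
      have "(a, y) \<in> G\<^sup>*" using that by (rule rtrancl_into_rtrancl)
      then have "x \<in> G\<^sup>* `` {a}" "y \<in> G\<^sup>* `` {a}" using that(1) by auto
      then show ?thesis using no that(2) \<open>(x, y) \<in> G \<Longrightarrow> (y, x) \<in> G\<close> by blast
    qed
    have "z \<in> S \<longleftrightarrow> a \<in> S" if "(a, z) \<in> G\<^sup>*" for z
      using that by (induction rule: rtrancl_induct) (use cut in auto)
    then have "S = {} \<or> S = G\<^sup>* `` {a}" using S(1) by blast
    then show False using S by blast
  qed
qed

text \<open>A rooted tree with vertices \<open>v 0, \<dots>, v (t - 1)\<close> in breadth-first order and parent function \<open>p\<close>.
  Monotonicity of \<open>p\<close> is what leaves only exponentially many shapes.\<close>

definition tree_code :: "nat \<Rightarrow> (nat \<Rightarrow> 'a) \<Rightarrow> (nat \<Rightarrow> nat) \<Rightarrow> bool" where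
  "tree_code t v p \<longleftrightarrow> inj_on v {..<t} \<and> (\<forall>i\<in>{1..<t}. p i < i) \<and> mono_on {1..<t} p"

definition tree_arcs :: "nat \<Rightarrow> (nat \<Rightarrow> 'a) \<Rightarrow> (nat \<Rightarrow> nat) \<Rightarrow> 'a rel" where
  "tree_arcs t v p = (\<lambda>i. (v (p i), v i)) ` {1..<t}"

text \<open>A parent has a smaller index than its child, so no tree arc is the reverse of another.
  Edge sets oriented once in this sense are what the switching bound accepts.\<close>

lemma tree_arcs_props:
  assumes "tree_code t v p"
  shows "inj_on (\<lambda>i. (v (p i), v i)) {1..<t}" "card (tree_arcs t v p) = t - 1"
    "finite (tree_arcs t v p)" "tree_arcs t v p \<inter> (tree_arcs t v p)\<inverse> = {}"
    "card (tree_arcs t v p \<union> (tree_arcs t v p)\<inverse>) = 2 * (t - 1)"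
proof -
  have v: "v i = v j \<longleftrightarrow> i = j" if "i < t" "j < t" for i j
    using assms that by (auto simp: tree_code_def inj_on_def)
  have p: "p i < i" if "i \<in> {1..<t}" for i using assms that by (auto simp: tree_code_def)
  show inj: "inj_on (\<lambda>i. (v (p i), v i)) {1..<t}" using v by (auto simp: inj_on_def)
  show c: "card (tree_arcs t v p) = t - 1" by (simp only: tree_arcs_def card_image[OF inj] card_atLeastLessThan)
  show f: "finite (tree_arcs t v p)" by (simp add: tree_arcs_def)
  have "False" if "i \<in> {1..<t}" "j \<in> {1..<t}" "v (p i) = v j" "v i = v (p j)" for i j
  proof -
    have "p i = j" "i = p j" using v[of "p i" j] v[of i "p j"] p[OF that(1)] p[OF that(2)] that by auto
    then show False using p[OF that(1)] p[OF that(2)] by linarith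
  qed
  then show d: "tree_arcs t v p \<inter> (tree_arcs t v p)\<inverse> = {}" unfolding tree_arcs_def by blast
  show "card (tree_arcs t v p \<union> (tree_arcs t v p)\<inverse>) = 2 * (t - 1)"
    using card_Un_disjoint[OF f _ d] f c by simp
qed

text \<open>Invariant: q bounds all parents so far, and every vertex of index below q is exhausted,
  that is, all its neighbours are in the tree. The next vertex is hung on the first vertex that is
  not exhausted; its index is at least q, which keeps the parent function monotone.\<close>

lemma breadth_first_tree:
  assumes X: "finite X" "connected_rel G X" and t: "1 \<le> t" "t \<le> card X"
  obtains v p where "tree_code t v p" "v ` {..<t} \<subseteq> X" "tree_arcs t v p \<subseteq> G"
proof -
  have "\<exists>v p q. inj_on v {..<t} \<and> v ` {..<t} \<subseteq> X \<and> (\<forall>i\<in>{1..<t}. p i < i \<and> p i \<le> q \<and> (v (p i), v i) \<in> G) \<and>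
      mono_on {1..<t} p \<and> q < t \<and> (\<forall>j<q. \<forall>y\<in>X. (v j, y) \<in> G \<longrightarrow> y \<in> v ` {..<t})"
    using t
  proof (induction t rule: nat_induct_at_least)
    case base
    then obtain x where "x \<in> X" by fastforce
    then show ?case
      by (intro exI[of _ "\<lambda>_. x"] exI[of _ "\<lambda>_. 0"] exI[of _ "0::nat"]) (auto simp: mono_on_def inj_on_def)
  next
    case (Suc t)
    then obtain v p q where v: "inj_on v {..<t}" "v ` {..<t} \<subseteq> X"
      and p: "\<And>i. i \<in> {1..<t} \<Longrightarrow> p i < i \<and> p i \<le> q \<and> (v (p i), v i) \<in> G"
      and mono: "mono_on {1..<t} p" and q: "q < t" "\<And>j y. j < q \<Longrightarrow> y \<in> X \<Longrightarrow> (v j, y) \<in> G \<Longrightarrow> y \<in> v ` {..<t}"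
    proof -
      have "t \<le> card X" using Suc.prems by simp
      from Suc.IH[OF this] show ?thesis using that by blast
    qed
    have "card (v ` {..<t}) = t" using v(1) by (simp add: card_image)
    then have ne: "v ` {..<t} \<noteq> X" using Suc.prems by auto
    have "v ` {..<t} \<noteq> {}" using q(1) by auto
    then obtain x0 y0 where xy0: "x0 \<in> v ` {..<t}" "y0 \<in> X - v ` {..<t}" "(x0, y0) \<in> G"
      using connected_relD[OF X(2) v(2) _ ne] by metis
    define out where "out = (\<lambda>j. j < t \<and> (\<exists>y\<in>X - v ` {..<t}. (v j, y) \<in> G))"
    have "\<exists>j. out j" using xy0 unfolding out_def by auto
    then have j: "out (LEAST j. out j)" and jmin: "\<And>i. i < (LEAST j. out j) \<Longrightarrow> \<not> out i"
      by (auto intro: LeastI_ex dest: not_less_Least)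
    define j where "j = (LEAST j. out j)"
    obtain y where y: "j < t" "y \<in> X" "y \<notin> v ` {..<t}" "(v j, y) \<in> G"
      using j unfolding out_def j_def by auto
    have qj: "q \<le> j" using q(2) y by (meson leI)
    have jmin: "z \<in> v ` {..<t}" if "i < j" "z \<in> X" "(v i, z) \<in> G" for i z
      using jmin[of i] that y(1) unfolding out_def j_def by auto
    let ?v = "v(t := y)" and ?p = "p(t := j)"
    have same: "?v ` {..<t} = v ` {..<t}" by auto
    have lt: "{..<Suc t} = insert t {..<t}" "{1..<Suc t} = insert t {1..<t}"
      using q(1) by auto
    have "inj_on ?v {..<Suc t}" unfolding lt using v(1) y(3) same
      by (auto simp: inj_on_def)
    moreover have "?v ` {..<Suc t} \<subseteq> X" unfolding lt using v(2) y(2) by auto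
    moreover have "?p i < i \<and> ?p i \<le> j \<and> (?v (?p i), ?v i) \<in> G" if "i \<in> {1..<Suc t}" for i
    proof (cases "i = t")
      case True
      then show ?thesis using y by auto
    next
      case False
      then have i: "i \<in> {1..<t}" using that by auto
      then show ?thesis using p[OF i] qj by auto
    qed
    moreover have "mono_on {1..<Suc t} ?p"
    proof (rule mono_onI)
      fix r s assume rs: "r \<in> {1..<Suc t}" "s \<in> {1..<Suc t}" "r \<le> s"
      consider "s < t" | "r = t" | "r < t" "s = t" using rs by fastforce
      then show "?p r \<le> ?p s"
      proof cases
        case 1
        then show ?thesis using mono rs unfolding mono_on_def by auto
      next
        case 2
        then show ?thesis using rs by auto
      next
        case 3
        then show ?thesis using p[of r] qj rs by auto
      qed
    qed
    moreover have "j < Suc t" using y(1) by simp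
    moreover have "z \<in> ?v ` {..<Suc t}" if "i < j" "z \<in> X" "(?v i, z) \<in> G" for i z
      using jmin[of i z] that y(1) same unfolding lt by auto
    ultimately show ?case by blast
  qed
  then show thesis using that unfolding tree_code_def tree_arcs_def by blast
qed

section \<open>Trees with many inner edges and bicyclic subgraphs\<close>

definition same_part :: "('a \<Rightarrow> nat) \<Rightarrow> 'a rel \<Rightarrow> 'a rel" where
  "same_part \<pi> G = {(x, y) \<in> G. \<pi> x = \<pi> y}"

text \<open>Edges count as two arcs, so the equation says that there is one edge less than vertices;
  together with connectedness this characterises trees.\<close>

definition span_tree :: "'a rel \<Rightarrow> 'a set \<Rightarrow> bool" where
  "span_tree T Y \<longleftrightarrow> finite Y \<and> sym T \<and> T \<subseteq> Y \<times> Y \<and> connected_rel T Y \<and> card T + 2 = 2 * card Y"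

lemma span_tree_insert:
  assumes T: "span_tree T Y" and x: "x \<in> Y" and y: "y \<notin> Y"
  defines "T' \<equiv> insert (x, y) (insert (y, x) T)"
  shows "span_tree T' (insert y Y)"
    "card (same_part \<pi> T') = card (same_part \<pi> T) + (if \<pi> x = \<pi> y then 2 else 0)"
proof -
  have TY: "T \<subseteq> Y \<times> Y" and finY: "finite Y" and c: "card T + 2 = 2 * card Y"
    and con: "connected_rel T Y" and s: "sym T"
    using T by (auto simp: span_tree_def)
  have finT: "finite T" using TY finY finite_subset by blast
  have new: "(x, y) \<notin> insert (y, x) T" "(y, x) \<notin> T" using TY x y by auto
  have "sym T'" using s by (auto simp: T'_def sym_def)
  moreover have "T' \<subseteq> insert y Y \<times> insert y Y" using TY x by (auto simp: T'_def)
  moreover have "card T' + 2 = 2 * card (insert y Y)" using new c finT finY y by (simp add: T'_def)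
  moreover have "connected_rel T' (insert y Y)"
    unfolding connected_rel_def
  proof (intro allI impI)
    fix S assume S: "S \<subseteq> insert y Y" "S \<noteq> {}" "S \<noteq> insert y Y"
    show "\<exists>a\<in>S. \<exists>b\<in>insert y Y - S. (a, b) \<in> T'"
    proof (cases "S \<inter> Y = {} \<or> S \<inter> Y = Y")
      case True
      then consider "S = {y}" | "S = Y" using S by blast
      then show ?thesis
      proof cases
        case 1
        then show ?thesis using x y by (auto simp: T'_def)
      next
        case 2
        then show ?thesis using x y by (auto simp: T'_def)
      qed
    next
      case False
      then obtain a b where "a \<in> S \<inter> Y" "b \<in> Y - S \<inter> Y" "(a, b) \<in> T"
        using connected_relD[OF con, of "S \<inter> Y"] by (metis inf_le2)
      then show ?thesis by (auto simp: T'_def)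
    qed
  qed
  ultimately show "span_tree T' (insert y Y)" using finY by (simp add: span_tree_def)
  have fi: "finite (same_part \<pi> T)" using finT by (auto simp: same_part_def intro: finite_subset)
  show "card (same_part \<pi> T') = card (same_part \<pi> T) + (if \<pi> x = \<pi> y then 2 else 0)"
  proof (cases "\<pi> x = \<pi> y")
    case True
    then have "same_part \<pi> T' = insert (x, y) (insert (y, x) (same_part \<pi> T))" by (auto simp: same_part_def T'_def)
    moreover have "(x, y) \<notin> insert (y, x) (same_part \<pi> T)" "(y, x) \<notin> same_part \<pi> T" using new by (auto simp: same_part_def)
    ultimately show ?thesis using fi True by simp
  next
    case False
    then have "same_part \<pi> T' = same_part \<pi> T" by (auto simp: same_part_def T'_def)
    then show ?thesis using False by simp
  qed
qed

text \<open>Whenever the tree is left along a non-inner edge, the inner edge at the new vertex is added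
  as well.\<close>

lemma ex_span_tree_many_inner:
  assumes X: "finite X" "connected_rel G X" and G: "sym G" "\<And>x. (x, x) \<notin> G"
    and inn: "\<And>x. x \<in> X \<Longrightarrow> \<exists>y\<in>X. (x, y) \<in> same_part \<pi> G"
    and t: "1 \<le> t" "t \<le> card X"
  shows "\<exists>Y T. Y \<subseteq> X \<and> T \<subseteq> G \<and> span_tree T Y \<and> card Y \<in> {t, Suc t} \<and> card Y \<le> Suc (card (same_part \<pi> T))"
  using t
proof (induction t rule: nat_induct_at_least)
  case base
  then obtain x where "x \<in> X" by fastforce
  then show ?case
    by (intro exI[of _ "{x}"] exI[of _ "{}"]) (auto simp: span_tree_def connected_rel_def sym_def)
next
  case (Suc t)
  then obtain Y T where Y: "Y \<subseteq> X" "T \<subseteq> G" "span_tree T Y" "card Y \<in> {t, Suc t}"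
    and many: "card Y \<le> Suc (card (same_part \<pi> T))" by (meson Suc_leD)
  show ?case
  proof (cases "card Y = Suc t")
    \<comment> \<open>A previous step that added two vertices has already reached this size.\<close>
    case True
    then show ?thesis using Y many by blast
  next
    case False
    then have cY: "card Y = t" using Y(4) by simp
    have finY: "finite Y" using Y(3) by (simp add: span_tree_def)
    have "Y \<noteq> {}" "Y \<noteq> X" using cY Suc by auto
    then obtain x y where xy: "x \<in> Y" "y \<in> X - Y" "(x, y) \<in> G"
      using connected_relD[OF X(2) Y(1)] by metis
    obtain z where z: "z \<in> X" "(y, z) \<in> G" and \<pi>z: "\<pi> y = \<pi> z" using inn[of y] xy by (auto simp: same_part_def)
    have rev: "(y, x) \<in> G" "(z, y) \<in> G" using xy z G(1) by (auto dest: symD)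
    have zy: "z \<noteq> y" using z G(2) by auto
    show ?thesis
    proof (cases "z \<in> Y")
      \<comment> \<open>Here y is hung on its inner neighbour z instead of x: one new vertex, and
        the new edge is inner. In the other case two new vertices bring one inner edge, that is, two
        inner arcs, so the invariant survives as well.\<close>
      case True
      let ?T = "insert (z, y) (insert (y, z) T)"
      have "span_tree ?T (insert y Y)" "card (same_part \<pi> ?T) = card (same_part \<pi> T) + 2"
        using span_tree_insert[OF Y(3) True, of y] xy \<pi>z by auto
      moreover have "?T \<subseteq> G" "insert y Y \<subseteq> X" using Y z rev xy by auto
      moreover have "card (insert y Y) = Suc t" using xy cY finY by simp
      ultimately show ?thesis using many cY by (intro exI[of _ "insert y Y"] exI[of _ ?T]) auto
    next
      case False
      let ?T1 = "insert (x, y) (insert (y, x) T)"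
      let ?T = "insert (y, z) (insert (z, y) ?T1)"
      have 1: "span_tree ?T1 (insert y Y)" "card (same_part \<pi> ?T1) \<ge> card (same_part \<pi> T)"
        using span_tree_insert[OF Y(3) xy(1), of y] xy by auto
      have "span_tree ?T (insert z (insert y Y))" "card (same_part \<pi> ?T) = card (same_part \<pi> ?T1) + 2"
        using span_tree_insert[OF 1(1), of y z] False zy \<pi>z by auto
      moreover have "?T \<subseteq> G" "insert z (insert y Y) \<subseteq> X" using Y z rev xy by auto
      moreover have "card (insert z (insert y Y)) = Suc (Suc t)" using xy cY finY False zy by simp
      ultimately show ?thesis using many cY 1(2)
        by (intro exI[of _ "insert z (insert y Y)"] exI[of _ ?T]) auto
    qed
  qed
qed

definition many_inner_tree :: "'a set \<Rightarrow> 'a rel \<Rightarrow> ('a \<Rightarrow> nat) \<Rightarrow> nat \<Rightarrow> bool" where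
  "many_inner_tree X G \<pi> t \<longleftrightarrow> (\<exists>v p. tree_code t v p \<and> v ` {..<t} \<subseteq> X \<and> tree_arcs t v p \<subseteq> G \<and>
     t \<le> Suc (2 * card {i\<in>{1..<t}. \<pi> (v (p i)) = \<pi> (v i)}))"

text \<open>The greedily grown tree is in no particular order, while only breadth-first codes are
  few enough to be counted. So the tree is traversed once more: a breadth-first tree of T that spans
  Y has as many arcs as T, hence is all of T and inherits its inner edges.\<close>

lemma many_inner_tree:
  assumes "finite X" "connected_rel G X" and "sym G" "\<And>x. (x, x) \<notin> G"
    and "\<And>x. x \<in> X \<Longrightarrow> \<exists>y\<in>X. (x, y) \<in> same_part \<pi> G"
    and t: "1 \<le> t" "t \<le> card X"
  shows "many_inner_tree X G \<pi> t \<or> many_inner_tree X G \<pi> (Suc t)"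
proof -
  obtain Y T where Y: "Y \<subseteq> X" "T \<subseteq> G" "span_tree T Y" "card Y \<in> {t, Suc t}"
    and many: "card Y \<le> Suc (card (same_part \<pi> T))"
    using ex_span_tree_many_inner[OF assms] by blast
  have T: "finite Y" "connected_rel T Y" "sym T" "T \<subseteq> Y \<times> Y" "card T + 2 = 2 * card Y"
    using Y(3) by (auto simp: span_tree_def)
  have finT: "finite T" using T finite_subset by blast
  have cY: "1 \<le> card Y" using Y(4) t by auto
  obtain v p where vp: "tree_code (card Y) v p" "v ` {..<card Y} \<subseteq> Y" "tree_arcs (card Y) v p \<subseteq> T"
    using breadth_first_tree[OF T(1,2) cY order_refl] by metis
  let ?F = "tree_arcs (card Y) v p"
  let ?S = "{i\<in>{1..<card Y}. \<pi> (v (p i)) = \<pi> (v i)}"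
  have "?F \<union> ?F\<inverse> \<subseteq> T" using vp(3) T(3) by (auto dest: symD)
  moreover have "card (?F \<union> ?F\<inverse>) = card T" using tree_arcs_props(5)[OF vp(1)] T(5) by simp
  ultimately have eq: "?F \<union> ?F\<inverse> = T" using finT by (simp add: card_subset_eq)
  have "same_part \<pi> T \<subseteq> (\<lambda>i. (v (p i), v i)) ` ?S \<union> (\<lambda>i. (v i, v (p i))) ` ?S"
    unfolding eq[symmetric] same_part_def tree_arcs_def by auto
  then have "card (same_part \<pi> T) \<le> card ((\<lambda>i. (v (p i), v i)) ` ?S \<union> (\<lambda>i. (v i, v (p i))) ` ?S)"
    by (intro card_mono) auto
  also have "\<dots> \<le> card ((\<lambda>i. (v (p i), v i)) ` ?S) + card ((\<lambda>i. (v i, v (p i))) ` ?S)" by (rule card_Un_le)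
  also have "\<dots> \<le> card ?S + card ?S" by (intro add_mono card_image_le) auto
  finally have "card Y \<le> Suc (2 * card ?S)" using many by simp
  then have "many_inner_tree X G \<pi> (card Y)"
    unfolding many_inner_tree_def using vp Y(1,2) by (intro exI[of _ v] exI[of _ p]) auto
  then show ?thesis using Y(4) by auto
qed

text \<open>The condition on \<open>F\<close> says that it consists of \<open>t + 1\<close> distinct edges, each in one orientation.\<close>

definition bicyclic_tree :: "'a set \<Rightarrow> 'a rel \<Rightarrow> nat \<Rightarrow> bool" where
  "bicyclic_tree X G t \<longleftrightarrow> (\<exists>v p a b a' b'. tree_code t v p \<and> v ` {..<t} \<subseteq> X \<and>
     a < t \<and> b < t \<and> a' < t \<and> b' < t \<and>
     (let F = insert (v a, v b) (insert (v a', v b') (tree_arcs t v p)) in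
        F \<subseteq> G \<and> F \<inter> F\<inverse> = {} \<and> card F = Suc t))"

text \<open>Arcs count both directions, so \<open>many\<close> says that there are more edges than
  vertices: two of them lie outside a spanning tree.\<close>

lemma bicyclic_tree:
  assumes X: "finite X" "connected_rel G X" "X \<noteq> {}" and G: "sym G" "\<And>x. (x, x) \<notin> G"
    and many: "2 * card X < card (G \<inter> X \<times> X)"
  shows "bicyclic_tree X G (card X)"
proof -
  have t: "1 \<le> card X" using X by (simp add: Suc_leI card_gt_0_iff)
  obtain v p where vp: "tree_code (card X) v p" "v ` {..<card X} \<subseteq> X" "tree_arcs (card X) v p \<subseteq> G"
    using breadth_first_tree[OF X(1,2) t order_refl] by metis
  let ?F = "tree_arcs (card X) v p"
  note F = tree_arcs_props[OF vp(1)]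
  have "card (v ` {..<card X}) = card X" using vp(1) by (simp add: tree_code_def card_image)
  then have vX: "v ` {..<card X} = X" using X(1) vp(2) card_subset_eq by blast
  have more: "\<exists>x y. (x, y) \<in> G \<and> x \<in> X \<and> y \<in> X \<and> (x, y) \<notin> S" if "finite S" "card S \<le> 2 * card X" for S
  proof (rule ccontr)
    assume "\<not> ?thesis"
    then have "G \<inter> X \<times> X \<subseteq> S" by blast
    then have "card (G \<inter> X \<times> X) \<le> card S" using that(1) by (rule card_mono[rotated])
    then show False using many that(2) by simp
  qed
  define D where "D = ?F \<union> ?F\<inverse>"
  have D: "finite D" "card D = 2 * (card X - 1)" using F(3,5) by (simp_all add: D_def)
  have "card D \<le> 2 * card X" using D by simp
  from more[OF D(1) this] obtain x y where e: "(x, y) \<in> G" "x \<in> X" "y \<in> X" "(x, y) \<notin> D"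
    by (elim exE conjE)
  \<comment> \<open>The tree and the first extra edge cover at most
    \<open>2 * (card X - 1) + 2\<close> arcs, so one arc is still left. Both directions of the first
    edge are excluded, which makes the second a different edge.\<close>
  have "card (insert (x, y) (insert (y, x) D)) \<le> 2 * card X"
    by (intro card_insert_le_m1) (use D(2) t in linarith)+
  moreover have "finite (insert (x, y) (insert (y, x) D))" using D(1) by simp
  ultimately have "\<exists>x' y'. (x', y') \<in> G \<and> x' \<in> X \<and> y' \<in> X \<and> (x', y') \<notin> insert (x, y) (insert (y, x) D)"
    using more by blast
  then obtain x' y' where e': "(x', y') \<in> G" "x' \<in> X" "y' \<in> X" "(x', y') \<notin> insert (x, y) (insert (y, x) D)"
    by (elim exE conjE)
  have "\<exists>i<card X. v i = w" if "w \<in> X" for w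
  proof -
    have "w \<in> v ` {..<card X}" using that by (simp only: vX)
    then show ?thesis by blast
  qed
  then obtain w where w: "\<And>z. z \<in> X \<Longrightarrow> w z < card X \<and> v (w z) = z" by metis
  have xy: "x \<noteq> y" "x' \<noteq> y'" using e(1) e'(1) G(2) by auto
  let ?F' = "insert (x, y) (insert (x', y') ?F)"
  have "?F' \<subseteq> G" using e e' vp(3) by auto
  moreover have "?F' \<inter> ?F'\<inverse> = {}" using F(4) e(4) e'(4) xy unfolding D_def by blast
  moreover have "card ?F' = Suc (card X)"
  proof -
    have "(x', y') \<notin> ?F" "(x, y) \<notin> insert (x', y') ?F" using e(4) e'(4) by (auto simp: D_def)
    then show ?thesis using F(2,3) t by simp
  qed
  ultimately have F': "?F' \<subseteq> G \<and> ?F' \<inter> ?F'\<inverse> = {} \<and> card ?F' = Suc (card X)" by blast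
  show ?thesis unfolding bicyclic_tree_def Let_def
    by (rule exI[of _ v], rule exI[of _ p], rule exI[of _ "w x"], rule exI[of _ "w y"],
        rule exI[of _ "w x'"], rule exI[of _ "w y'"])
       (use F' vp(1,2) w e(2,3) e'(2,3) in simp)
qed

lemma many_inner_tree_mono: "many_inner_tree Z G \<pi> t \<Longrightarrow> Z \<subseteq> X \<Longrightarrow> many_inner_tree X G \<pi> t"
  unfolding many_inner_tree_def by blast

lemma bicyclic_tree_mono: "bicyclic_tree Z G t \<Longrightarrow> Z \<subseteq> X \<Longrightarrow> bicyclic_tree X G t"
  unfolding bicyclic_tree_def by (meson order_trans)

section \<open>Local sparseness yields peelability\<close>

lemma card_arcs_connected:
  assumes "finite C" "C \<noteq> {}" "connected_rel I C" "sym I" "I \<inter> C \<times> C \<subseteq> A" "finite A"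
  shows "2 * card C \<le> card A + 2"
proof -
  have 1: "1 \<le> card C" using assms(1,2) by (simp add: Suc_leI card_gt_0_iff)
  obtain v p where vp: "tree_code (card C) v p" "v ` {..<card C} \<subseteq> C" "tree_arcs (card C) v p \<subseteq> I"
    using breadth_first_tree[OF assms(1,3) 1 order_refl] by metis
  have "p i < card C" if "i \<in> {1..<card C}" for i
    using vp(1) that unfolding tree_code_def by (meson atLeastLessThan_iff less_trans)
  then have "tree_arcs (card C) v p \<subseteq> I \<inter> C \<times> C"
    using vp(2,3) unfolding tree_arcs_def by fastforce
  then have "tree_arcs (card C) v p \<union> (tree_arcs (card C) v p)\<inverse> \<subseteq> A"
    using assms(4,5) by (auto dest: symD)
  then have "2 * (card C - 1) \<le> card A"
    using card_mono[OF assms(6)] tree_arcs_props(5)[OF vp(1)] by metis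
  then show ?thesis by linarith
qed

text \<open>A vertex of Y without inner neighbours can be peeled alone. Otherwise every vertex of a
  component Z of the graph on Y has an inner neighbour in Z, so a large Z would contain a tree with
  many inner edges. A small Z has at most as many edges as vertices, and averaging over its inner
  components finds one with few edges leaving it.\<close>

lemma peelable_if_locally_sparse:
  fixes G :: "'a::linorder rel"
  assumes X: "finite X" and G: "sym G" "\<And>x. (x, x) \<notin> G" "G \<subseteq> X \<times> X"
    and deg: "\<And>x. x \<in> X \<Longrightarrow> card (G `` {x}) \<le> d" and d: "2 \<le> d" and t: "1 \<le> t"
    and A: "\<not> many_inner_tree X G \<pi> t" "\<not> many_inner_tree X G \<pi> (Suc t)"
    and B: "\<And>s. 1 \<le> s \<Longrightarrow> s \<le> t \<Longrightarrow> \<not> bicyclic_tree X G s"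
  shows "peelable d t X {(x, y) \<in> G. x < y} \<pi>"
proof -
  have Gsym: "(x, y) \<in> G \<Longrightarrow> (y, x) \<in> G" for x y using G(1) by (auto dest: symD)
  have nb: "nbrs {(x, y) \<in> G. x < y} x = G `` {x}" for x
  proof -
    have "y \<in> nbrs {(x, y) \<in> G. x < y} x \<longleftrightarrow> (x, y) \<in> G" for y
      using Gsym[of x y] Gsym[of y x] G(2)[of x] by (cases x y rule: linorder_cases) (auto simp: nbrs_def)
    then show ?thesis by auto
  qed
  have finG: "finite G" using X G(3) finite_subset by blast
  show ?thesis
    unfolding peelable_def inner_closed_def nb
  proof (intro allI impI)
    fix Y assume YX: "Y \<subseteq> X" and Y0: "Y \<noteq> {}"
      and "\<forall>x\<in>Y. \<forall>y\<in>X. y \<in> G `` {x} \<longrightarrow> \<pi> x = \<pi> y \<longrightarrow> y \<in> Y"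
    then have cl: "y \<in> Y" if "x \<in> Y" "(x, y) \<in> G" "\<pi> x = \<pi> y" for x y
      using that G(3) by auto
    let ?goal = "\<lambda>C. C \<noteq> {} \<and> (\<forall>x\<in>C. \<forall>y\<in>X. y \<in> G `` {x} \<longrightarrow> \<pi> x = \<pi> y \<longrightarrow> y \<in> C) \<and>
        (\<exists>j. \<forall>x\<in>C. \<pi> x = j) \<and> card C \<le> t \<and> card {(x, y). x \<in> C \<and> y \<in> Y - C \<and> y \<in> G `` {x}} \<le> d"
    show "\<exists>C\<subseteq>Y. ?goal C"
    proof (cases "\<exists>x\<in>Y. \<forall>y. (x, y) \<in> G \<longrightarrow> \<pi> x \<noteq> \<pi> y")
      case True
      then obtain x where x: "x \<in> Y" "\<And>y. (x, y) \<in> G \<Longrightarrow> \<pi> x \<noteq> \<pi> y" by blast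
      have "{(x', y). x' \<in> {x} \<and> y \<in> Y - {x} \<and> y \<in> G `` {x'}} \<subseteq> Pair x ` (G `` {x})" by auto
      moreover have "finite (G `` {x})" using finG by (rule finite_Image)
      ultimately have "card {(x', y). x' \<in> {x} \<and> y \<in> Y - {x} \<and> y \<in> G `` {x'}} \<le> card (G `` {x})"
        using surj_card_le by blast
      also have "\<dots> \<le> d" using deg x(1) YX by blast
      finally show ?thesis using x t by (intro exI[of _ "{x}"]) auto
    next
      case False
      define R where "R = G \<inter> Y \<times> Y"
      have symR: "sym R" using Gsym by (auto simp: R_def sym_def)
      obtain y0 where y0: "y0 \<in> Y" using Y0 by blast
      define Z where "Z = R\<^sup>* `` {y0}"
      have ZY: "Z \<subseteq> Y"
      proof
        fix z assume "z \<in> Z"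
        then have "(y0, z) \<in> R\<^sup>*" by (simp add: Z_def)
        then show "z \<in> Y" by (induction rule: rtrancl_induct) (use y0 in \<open>auto simp: R_def\<close>)
      qed
      have ZX: "Z \<subseteq> X" using ZY YX by (rule order_trans)
      then have finZ: "finite Z" using X by (rule finite_subset)
      have Z0: "Z \<noteq> {}" by (auto simp: Z_def)
      have Zcl: "y \<in> Z" if "x \<in> Z" "y \<in> Y" "(x, y) \<in> G" for x y
      proof -
        have "(x, y) \<in> R" using that ZY by (auto simp: R_def)
        then show ?thesis using that(1) by (auto simp: Z_def intro: rtrancl_into_rtrancl)
      qed
      have conZ: "connected_rel G Z"
        unfolding Z_def by (rule connected_rel_mono[OF connected_rel_rtrancl[OF symR]]) (simp add: R_def)
      have innZ: "\<exists>y\<in>Z. (x, y) \<in> same_part \<pi> G" if x: "x \<in> Z" for x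
      proof -
        have "x \<in> Y" using x ZY by blast
        then obtain y where y: "(x, y) \<in> G" "\<pi> x = \<pi> y" using False by blast
        then have "y \<in> Y" using cl \<open>x \<in> Y\<close> by blast
        then show ?thesis using Zcl[OF x _ y(1)] y by (auto simp: same_part_def)
      qed
      have Zt: "card Z \<le> t"
      proof (rule ccontr)
        assume "\<not> card Z \<le> t"
        then have "t \<le> card Z" by simp
        then show False
          using many_inner_tree[OF finZ conZ G(1,2) innZ t] many_inner_tree_mono[OF _ ZX] A by blast
      qed
      have Z1: "1 \<le> card Z" using Z0 finZ by (simp add: Suc_leI card_gt_0_iff)
      have few: "card (G \<inter> Z \<times> Z) \<le> 2 * card Z"
      proof (rule ccontr)
        assume "\<not> ?thesis"
        then have "bicyclic_tree Z G (card Z)"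
          using bicyclic_tree[OF finZ conZ Z0 G(1,2)] by simp
        then show False using B[OF Z1 Zt] bicyclic_tree_mono ZX by blast
      qed
      define I where "I = same_part \<pi> G \<inter> Z \<times> Z"
      have symI: "sym I" using Gsym by (auto simp: I_def same_part_def sym_def)
      define part where "part = (\<lambda>x. I\<^sup>* `` {x})"
      have partI: "part x \<subseteq> Z \<and> (\<forall>y\<in>part x. \<pi> y = \<pi> x)" if x: "x \<in> Z" for x
      proof -
        have "y \<in> Z \<and> \<pi> y = \<pi> x" if "(x, y) \<in> I\<^sup>*" for y
          using that by (induction rule: rtrancl_induct) (use x in \<open>auto simp: I_def same_part_def\<close>)
        then show ?thesis unfolding part_def by blast
      qed
      have self: "x \<in> part x" for x by (simp add: part_def)
      have same: "part x = part y" if "y \<in> part x" for x y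
      proof -
        have xy: "(x, y) \<in> I\<^sup>*" using that by (simp add: part_def)
        then have "(y, x) \<in> I\<^sup>*" using sym_rtrancl[OF symI] by (auto dest: symD)
        then have "(x, z) \<in> I\<^sup>* \<longleftrightarrow> (y, z) \<in> I\<^sup>*" for z using xy by (blast intro: rtrancl_trans)
        then show ?thesis unfolding part_def by blast
      qed
      \<comment> \<open>Otherwise the at least \<open>2 |C| - 2\<close> inner arcs and \<open>3\<close> leaving arcs of every part \<open>C\<close>
        would add up to more than \<open>2 |Z|\<close> arcs.\<close>
      have "\<exists>x\<in>Z. card {(a, y). a \<in> part x \<and> y \<in> Y - part x \<and> y \<in> G `` {a}} \<le> d"
      proof (rule ccontr)
        assume no: "\<not> ?thesis"
        let ?\<C> = "part ` Z"
        have big: "2 * card C + 1 \<le> card (G \<inter> C \<times> Z)" if C: "C \<in> ?\<C>" for C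
        proof -
          obtain x where x: "x \<in> Z" "C = part x" using C by blast
          have CZ: "C \<subseteq> Z" and C\<pi>: "\<And>y. y \<in> C \<Longrightarrow> \<pi> y = \<pi> x" using partI[OF x(1)] unfolding x(2) by blast+
          have finC: "finite C" using CZ finZ by (rule finite_subset)
          have C0: "C \<noteq> {}" using self x(2) by blast
          have con: "connected_rel I C" unfolding x(2) part_def by (rule connected_rel_rtrancl[OF symI])
          have "2 * card C \<le> card (G \<inter> C \<times> C) + 2"
            by (rule card_arcs_connected[OF finC C0 con symI])
               (use finC in \<open>auto simp: I_def same_part_def\<close>)
          moreover have "d < card (G \<inter> C \<times> (Z - C))"
          proof -
            have "{(a, y). a \<in> C \<and> y \<in> Y - C \<and> y \<in> G `` {a}} = G \<inter> C \<times> (Z - C)"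
              using Zcl CZ ZY by auto
            moreover have "\<not> card {(a, y). a \<in> C \<and> y \<in> Y - C \<and> y \<in> G `` {a}} \<le> d"
              unfolding x(2) using no x(1) by blast
            ultimately show ?thesis by simp
          qed
          moreover have "card (G \<inter> C \<times> Z) = card (G \<inter> C \<times> C) + card (G \<inter> C \<times> (Z - C))"
          proof -
            have "G \<inter> C \<times> Z = (G \<inter> C \<times> C) \<union> (G \<inter> C \<times> (Z - C))" using CZ by blast
            moreover have "(G \<inter> C \<times> C) \<inter> (G \<inter> C \<times> (Z - C)) = {}" by blast
            ultimately show ?thesis using finG by (metis card_Un_disjoint finite_Int)
          qed
          ultimately show ?thesis using d by linarith
        qed
        have fin\<C>: "finite ?\<C>" using finZ by simp
        have disj: "C \<inter> D = {}" if "C \<in> ?\<C>" "D \<in> ?\<C>" "C \<noteq> D" for C D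
          using that same by blast
        have U: "(\<Union>C\<in>?\<C>. C) = Z" using partI self by blast
        have finC: "finite C" if "C \<in> ?\<C>" for C 
        proof -
          have "C \<subseteq> Z" using that U by blast
          then show ?thesis using finZ by (rule finite_subset)
        qed
        have "card Z = (\<Sum>C\<in>?\<C>. card C)"
          by (subst U[symmetric], rule card_UN_disjoint) (use fin\<C> finC disj in auto)
        moreover have "(\<Union>C\<in>?\<C>. G \<inter> C \<times> Z) = G \<inter> Z \<times> Z" using U by blast
        moreover have "card (\<Union>C\<in>?\<C>. G \<inter> C \<times> Z) = (\<Sum>C\<in>?\<C>. card (G \<inter> C \<times> Z))"
          by (rule card_UN_disjoint) (use fin\<C> finG disj in auto)
        moreover have "(\<Sum>C\<in>?\<C>. 2 * card C + 1) \<le> (\<Sum>C\<in>?\<C>. card (G \<inter> C \<times> Z))"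
          by (intro sum_mono big)
        moreover have "(\<Sum>C\<in>?\<C>. 2 * card C + 1) = 2 * (\<Sum>C\<in>?\<C>. card C) + card ?\<C>"
          by (simp only: sum.distrib sum_distrib_left) simp
        moreover have "card ?\<C> > 0" using Z0 fin\<C> by (simp add: card_gt_0_iff)
        ultimately show False using few by simp
      qed
      then obtain x where x: "x \<in> Z" "card {(a, y). a \<in> part x \<and> y \<in> Y - part x \<and> y \<in> G `` {a}} \<le> d"
        by blast
      have pZ: "part x \<subseteq> Z" and p\<pi>: "\<And>y. y \<in> part x \<Longrightarrow> \<pi> y = \<pi> x" using partI[OF x(1)] by blast+
      have "card (part x) \<le> t" using card_mono[OF finZ pZ] Zt by linarith
      moreover have "b \<in> part x" if "a \<in> part x" "b \<in> X" "b \<in> G `` {a}" "\<pi> a = \<pi> b" for a b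
      proof -
        have "a \<in> Z" "(a, b) \<in> G" using that pZ by auto
        then have "b \<in> Z" using Zcl cl ZY that(4) by blast
        then have "(a, b) \<in> I" using that \<open>a \<in> Z\<close> by (auto simp: I_def same_part_def)
        then show ?thesis using that(1) unfolding part_def by (auto intro: rtrancl_into_rtrancl)
      qed
      ultimately show ?thesis using x(2) pZ p\<pi> ZY self[of x]
        by (intro exI[of _ "part x"]) blast
    qed
  qed
qed

section \<open>Random regular graphs\<close>

definition regular_rels :: "nat \<Rightarrow> nat \<Rightarrow> nat rel set" where
  "regular_rels n d = {A. A \<subseteq> {1..n} \<times> {1..n} \<and> sym A \<and> (\<forall>x. (x, x) \<notin> A) \<and> (\<forall>x\<in>{1..n}. card (A `` {x}) = d)}"

lemma finite_regular_rels: "finite (regular_rels n d)"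
  by (rule finite_subset[of _ "Pow ({1..n} \<times> {1..n})"]) (auto simp: regular_rels_def)

lemma regular_relsD:
  assumes "A \<in> regular_rels n d"
  shows "A \<subseteq> {1..n} \<times> {1..n}" "finite A" "\<And>x y. (x, y) \<in> A \<Longrightarrow> (y, x) \<in> A" "\<And>x. (x, x) \<notin> A"
    "\<And>x. x \<in> {1..n} \<Longrightarrow> card (A `` {x}) = d" "\<And>x. finite (A `` {x})" "\<And>x. card (A `` {x}) \<le> d"
proof -
  show *: "A \<subseteq> {1..n} \<times> {1..n}" "\<And>x y. (x, y) \<in> A \<Longrightarrow> (y, x) \<in> A" "\<And>x. (x, x) \<notin> A"
    "\<And>x. x \<in> {1..n} \<Longrightarrow> card (A `` {x}) = d"
    using assms by (auto simp: regular_rels_def dest: symD)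
  show f: "finite A" by (rule finite_subset[OF *(1)]) simp
  show "finite (A `` {x})" for x using f by (rule finite_Image)
  show "card (A `` {x}) \<le> d" for x
  proof (cases "x \<in> {1..n}")
    case False
    then have "A `` {x} = {}" using *(1) by blast
    then show ?thesis by simp
  qed (simp add: *(4))
qed

lemma card_regular_rel:
  assumes "A \<in> regular_rels n d"
  shows "card A = n * d"
proof -
  note A = regular_relsD[OF assms]
  have "A = Sigma {1..n} (\<lambda>x. A `` {x})" using A(1) by auto
  then have "card A = card (Sigma {1..n} (\<lambda>x. A `` {x}))" by simp
  also have "\<dots> = (\<Sum>x\<in>{1..n}. card (A `` {x}))" using A(6) by (intro card_SigmaI) auto
  also have "\<dots> = n * d" using A(5) by simp
  finally show ?thesis .
qed

section \<open>Switching\<close>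

definition switch :: "'a \<Rightarrow> 'a \<Rightarrow> 'a \<Rightarrow> 'a \<Rightarrow> 'a rel \<Rightarrow> 'a rel" where
  "switch u v x y A = (A - {(u, v), (v, u), (x, y), (y, x)}) \<union> {(u, x), (x, u), (v, y), (y, v)}"

lemma card_exchange: "finite S \<Longrightarrow> a \<in> S \<Longrightarrow> b \<notin> S \<Longrightarrow> card (insert b (S - {a})) = card S"
  by (metis card.insert_remove card_Suc_Diff1 finite_Diff insert_Diff_single insert_absorb
      Diff_insert_absorb Diff_iff card_insert_disjoint)

text \<open>Each of the four distinct vertices trades one neighbour for a new one; the last two
  assumptions ensure that the new one is not a neighbour already.\<close>

lemma switch_regular:
  assumes A: "A \<in> regular_rels n d" and uv: "(u, v) \<in> A" and xy: "(x, y) \<in> A"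
    and ne: "x \<noteq> u" "x \<noteq> v" "y \<noteq> u" "y \<noteq> v" and new: "(u, x) \<notin> A" "(v, y) \<notin> A"
  shows "switch u v x y A \<in> regular_rels n d"
proof -
  note a = regular_relsD[OF A]
  have ne': "u \<noteq> v" "x \<noteq> y" using uv xy a(4) by auto
  have new': "(x, u) \<notin> A" "(y, v) \<notin> A" using new a(3) by blast+
  have old': "(v, u) \<in> A" "(y, x) \<in> A" using uv xy a(3) by blast+
  have "card (switch u v x y A `` {w}) = d" if w: "w \<in> {1..n}" for w
  proof -
    consider "w = u" | "w = v" | "w = x" | "w = y" | "w \<notin> {u, v, x, y}" by blast
    then show ?thesis
    proof cases
      case 1
      then have "switch u v x y A `` {w} = insert x (A `` {u} - {v})"
        using ne ne' by (auto simp: switch_def)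
      then show ?thesis using card_exchange[of "A `` {u}" v x] a(5,6) uv new w 1 by simp
    next
      case 2
      then have "switch u v x y A `` {w} = insert y (A `` {v} - {u})"
        using ne ne' by (auto simp: switch_def)
      then show ?thesis using card_exchange[of "A `` {v}" u y] a(5,6) old' new w 2 by simp
    next
      case 3
      then have "switch u v x y A `` {w} = insert u (A `` {x} - {y})"
        using ne ne' by (auto simp: switch_def)
      then show ?thesis using card_exchange[of "A `` {x}" y u] a(5,6) xy new' w 3 by simp
    next
      case 4
      then have "switch u v x y A `` {w} = insert v (A `` {y} - {x})"
        using ne ne' by (auto simp: switch_def)
      then show ?thesis using card_exchange[of "A `` {y}" x v] a(5,6) old' new' w 4 by simp
    next
      case 5
      then have "switch u v x y A `` {w} = A `` {w}" by (auto simp: switch_def)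
      then show ?thesis using a(5) w by simp
    qed
  qed
  moreover have "switch u v x y A \<subseteq> {1..n} \<times> {1..n}" using a(1) uv xy by (auto simp: switch_def)
  moreover have "sym (switch u v x y A)" using a(3) by (auto simp: switch_def sym_def)
  moreover have "(z, z) \<notin> switch u v x y A" for z using a(4) ne by (auto simp: switch_def)
  ultimately show ?thesis by (auto simp: regular_rels_def)
qed

text \<open>Double counting of the switches that destroy uv and keep F. A graph containing uv and F
  admits an arc (x, y) unless it meets u or v (4 d arcs), has x adjacent to u or y adjacent to v (d
  * d each), or belongs to F in some direction. Conversely, in the switched graph x is a neighbour
  of u and y one of v, which leaves d * d possibilities.\<close>

lemma switching_bound:
  assumes uv: "(u, v) \<notin> F" "(v, u) \<notin> F" and F: "finite F"
  shows "card {A \<in> regular_rels n d. insert (u, v) F \<subseteq> A} * (n * d - (4 * d + 2 * (d * d) + 2 * card F))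
    \<le> card {A \<in> regular_rels n d. F \<subseteq> A} * (d * d)"
proof -
  define P where "P = {A \<in> regular_rels n d. insert (u, v) F \<subseteq> A}"
  define Q where "Q = {A \<in> regular_rels n d. F \<subseteq> A}"
  have finP: "finite P" and finQ: "finite Q" using finite_regular_rels by (auto simp: P_def Q_def)
  define ok where "ok = (\<lambda>A. {(x, y) \<in> A. x \<noteq> u \<and> x \<noteq> v \<and> y \<noteq> u \<and> y \<noteq> v \<and> (u, x) \<notin> A \<and> (v, y) \<notin> A \<and>
    (x, y) \<notin> F \<and> (y, x) \<notin> F})"
  have ok: "n * d - (4 * d + 2 * (d * d) + 2 * card F) \<le> card (ok A)" if "A \<in> P" for A
  proof -
    have A: "A \<in> regular_rels n d" using that by (simp add: P_def)
    note a = regular_relsD[OF A]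
    \<comment> \<open>The arcs that cannot be used: tail in {u, v}, head in {u, v}, tail adjacent to
      u, head adjacent to v.\<close>
    define B1 where "B1 = Pair u ` (A `` {u}) \<union> Pair v ` (A `` {v})"
    define B2 where "B2 = (\<lambda>x. (x, u)) ` (A `` {u}) \<union> (\<lambda>x. (x, v)) ` (A `` {v})"
    define B3 where "B3 = Sigma (A `` {u}) (\<lambda>x. A `` {x})"
    define B4 where "B4 = (\<lambda>(y, x). (x, y)) ` Sigma (A `` {v}) (\<lambda>y. A `` {y})"
    have im: "card (f ` (A `` {z})) \<le> d" for f :: "nat \<Rightarrow> nat \<times> nat" and z
      using card_image_le[OF a(6), of f z] a(7)[of z] by linarith
    have sg: "card (Sigma (A `` {z}) (\<lambda>x. A `` {x})) \<le> d * d" for z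
    proof -
      have "card (Sigma (A `` {z}) (\<lambda>x. A `` {x})) = (\<Sum>x\<in>A `` {z}. card (A `` {x}))"
        using a(6) by (intro card_SigmaI) auto
      also have "\<dots> \<le> (\<Sum>x\<in>A `` {z}. d)" by (intro sum_mono a(7))
      also have "\<dots> \<le> d * d" using a(7)[of z] by simp
      finally show ?thesis .
    qed
    have c1: "card B1 \<le> 2 * d" unfolding B1_def using card_Un_le order_trans add_mono[OF im im]
      by (metis mult_2)
    have c2: "card B2 \<le> 2 * d" unfolding B2_def using card_Un_le order_trans add_mono[OF im im]
      by (metis mult_2)
    have c3: "card B3 \<le> d * d" unfolding B3_def by (rule sg)
    have f3: "finite (Sigma (A `` {z}) (\<lambda>x. A `` {x}))" for z using a(6) by auto
    have c4: "card B4 \<le> d * d" unfolding B4_def using card_image_le[OF f3] sg by (rule order_trans)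
    have fin: "finite (B1 \<union> (B2 \<union> (B3 \<union> (B4 \<union> (F \<union> F\<inverse>)))))"
      using a(6) F f3 by (auto simp: B1_def B2_def B3_def B4_def)
    have "A - ok A \<subseteq> B1 \<union> (B2 \<union> (B3 \<union> (B4 \<union> (F \<union> F\<inverse>))))"
      unfolding ok_def B1_def B2_def B3_def B4_def using a(3) by (auto simp: image_iff)
    then have "card (A - ok A) \<le> card (B1 \<union> (B2 \<union> (B3 \<union> (B4 \<union> (F \<union> F\<inverse>)))))"
      using fin by (intro card_mono)
    also have "\<dots> \<le> card B1 + (card B2 + (card B3 + (card B4 + (card F + card (F\<inverse>)))))"
      by (rule order_trans[OF card_Un_le add_left_mono])+ simp
    also have "\<dots> \<le> 4 * d + 2 * (d * d) + 2 * card F" using c1 c2 c3 c4 by (simp add: card_inverse)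
    finally have "card (A - ok A) \<le> 4 * d + 2 * (d * d) + 2 * card F" .
    moreover have okA: "ok A \<subseteq> A" by (auto simp: ok_def)
    then have "card (A - ok A) = card A - card (ok A)"
      using a(2) by (intro card_Diff_subset) (auto intro: finite_subset)
    ultimately show ?thesis using card_regular_rel[OF A] by linarith
  qed
  define \<Phi> where "\<Phi> = (\<lambda>(A, x, y). (switch u v x y A, x, y))"
  have finok: "finite (ok A)" if "A \<in> P" for A
    using that regular_relsD(2)[of A n d] by (auto simp: P_def ok_def intro: finite_subset)
  have "inj_on \<Phi> (Sigma P ok)"
  proof (rule inj_onI)
    fix s s' assume s: "s \<in> Sigma P ok" "s' \<in> Sigma P ok" "\<Phi> s = \<Phi> s'"
    obtain A x y A' where ss: "s = (A, x, y)" "s' = (A', x, y)" "switch u v x y A = switch u v x y A'"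
      using s(3) by (cases s; cases s') (auto simp: \<Phi>_def)
    \<comment> \<open>Knowing x and y, the switch can be undone; this is why \<Phi> records
      them.\<close>
    have rec: "D = (switch u v x y D - {(u, x), (x, u), (v, y), (y, v)}) \<union> {(u, v), (v, u), (x, y), (y, x)}"
      if D: "(D, x, y) \<in> Sigma P ok" for D
    proof -
      have DR: "D \<in> regular_rels n d" using D by (simp add: P_def)
      note dd = regular_relsD[OF DR]
      have "(u, v) \<in> D" "(x, y) \<in> D" "(u, x) \<notin> D" "(v, y) \<notin> D" using D by (auto simp: P_def ok_def)
      moreover from this have "(v, u) \<in> D" "(y, x) \<in> D" "(x, u) \<notin> D" "(y, v) \<notin> D" using dd(3) by blast+
      ultimately show ?thesis unfolding switch_def by auto
    qed
    show "s = s'" using rec[of A] rec[of A'] s(1,2) ss by simp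
  qed
  moreover have "\<Phi> ` Sigma P ok \<subseteq> Sigma Q (\<lambda>A. A `` {u} \<times> A `` {v})"
  proof
    fix z assume "z \<in> \<Phi> ` Sigma P ok"
    then obtain A x y where z: "z = (switch u v x y A, x, y)" "A \<in> P" "(x, y) \<in> ok A" by (auto simp: \<Phi>_def)
    have A: "A \<in> regular_rels n d" "insert (u, v) F \<subseteq> A" using z(2) by (auto simp: P_def)
    have "switch u v x y A \<in> regular_rels n d"
      using z(3) A by (intro switch_regular) (auto simp: ok_def)
    moreover have "F \<subseteq> switch u v x y A" using z(3) A(2) uv by (auto simp: ok_def switch_def)
    ultimately show "z \<in> Sigma Q (\<lambda>A. A `` {u} \<times> A `` {v})"
      using z(1) by (auto simp: Q_def switch_def)
  qed
  moreover have finT: "finite (Sigma Q (\<lambda>A. A `` {u} \<times> A `` {v}))"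
    using finQ regular_relsD(6) by (auto simp: Q_def)
  ultimately have "card (Sigma P ok) \<le> card (Sigma Q (\<lambda>A. A `` {u} \<times> A `` {v}))"
    by (rule card_inj_on_le)
  also have "\<dots> = (\<Sum>A\<in>Q. card (A `` {u} \<times> A `` {v}))"
    using finQ regular_relsD(6) by (intro card_SigmaI) (auto simp: Q_def)
  also have "\<dots> \<le> (\<Sum>A\<in>Q. d * d)"
    unfolding card_cartesian_product by (intro sum_mono mult_le_mono regular_relsD(7)) (auto simp: Q_def)
  finally have "card (Sigma P ok) \<le> card Q * (d * d)" by simp
  moreover have "card (Sigma P ok) = (\<Sum>A\<in>P. card (ok A))" using finP finok by (intro card_SigmaI) auto
  moreover have "(\<Sum>A\<in>P. n * d - (4 * d + 2 * (d * d) + 2 * card F)) \<le> (\<Sum>A\<in>P. card (ok A))"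
    by (intro sum_mono ok)
  ultimately show ?thesis by (simp add: P_def Q_def)
qed

text \<open>The edges of F are added one at a time. The assumption on n keeps at least half of the
  \<open>n * d\<close> arcs switchable, so each edge costs a factor d * d / (n d / 2) = 2 d /
  n.\<close>

lemma card_regular_rels_containing:
  assumes F: "finite F" "F \<inter> F\<inverse> = {}" and d: "d > 0"
    and n: "2 * (4 * d + 2 * (d * d) + 2 * card F) \<le> n * d"
  shows "card {A \<in> regular_rels n d. F \<subseteq> A} \<le> (2 * real d / real n) ^ card F * card (regular_rels n d)"
  using F n
proof (induction F rule: finite_induct)
  case empty
  then show ?case by simp
next
  case (insert e F)
  obtain u v where e: "e = (u, v)" by (cases e)
  have uv: "(u, v) \<notin> F" "(v, u) \<notin> F" using insert.hyps insert.prems(1) by (auto simp: e)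
  have n0: "n > 0" using insert.prems(2) d by (cases n) auto
  have IH: "card {A \<in> regular_rels n d. F \<subseteq> A} \<le> (2 * real d / real n) ^ card F * card (regular_rels n d)"
    using insert.prems insert.hyps by (intro insert.IH) auto
  let ?P = "card {A \<in> regular_rels n d. insert e F \<subseteq> A}" and ?Q = "card {A \<in> regular_rels n d. F \<subseteq> A}"
  have "n * d \<le> 2 * (n * d - (4 * d + 2 * (d * d) + 2 * card F))"
    using insert.prems(2) insert.hyps by simp
  then have "?P * (n * d) \<le> ?P * (2 * (n * d - (4 * d + 2 * (d * d) + 2 * card F)))" by (rule mult_le_mono2)
  also have "\<dots> = 2 * (?P * (n * d - (4 * d + 2 * (d * d) + 2 * card F)))" by simp
  also have "\<dots> \<le> 2 * (?Q * (d * d))"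
    unfolding e by (intro mult_le_mono2 switching_bound uv insert.hyps(1))
  finally have "(?P * n) * d \<le> (2 * ?Q * d) * d" by (simp only: mult_ac)
  then have "?P * n \<le> 2 * ?Q * d" using d by simp
  then have "real (?P * n) \<le> real (2 * ?Q * d)" by (rule of_nat_mono)
  then have "real ?P * real n \<le> 2 * real d * real ?Q" by (simp only: of_nat_mult of_nat_numeral mult_ac)
  then have "real ?P \<le> 2 * real d / real n * real ?Q" using n0 by (simp add: field_simps)
  also have "\<dots> \<le> 2 * real d / real n * ((2 * real d / real n) ^ card F * card (regular_rels n d))"
    by (intro mult_left_mono IH) simp
  finally show ?case using insert.hyps by simp
qed

section \<open>First moment bounds\<close>

lemma card_UN_le_mult:
  fixes c :: real
  assumes "finite I" "\<And>i. i \<in> I \<Longrightarrow> card (B i) \<le> c"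
  shows "card (\<Union>i\<in>I. B i) \<le> card I * c"
proof -
  have "real (card (\<Union>i\<in>I. B i)) \<le> real (\<Sum>i\<in>I. card (B i))"
    using card_UN_le[OF assms(1)] by (rule of_nat_mono)
  also have "\<dots> = (\<Sum>i\<in>I. real (card (B i)))" by simp
  also have "\<dots> \<le> (\<Sum>i\<in>I. c)" by (intro sum_mono assms(2))
  finally show ?thesis by simp
qed

text \<open>The index of a value is recovered from its rank in the image.\<close>

lemma strict_mono_on_eq_if_image_eq:
  fixes g h :: "nat \<Rightarrow> nat"
  assumes g: "strict_mono_on {1..<t} g" and h: "strict_mono_on {1..<t} h"
    and im: "g ` {1..<t} = h ` {1..<t}" and i: "i \<in> {1..<t}"
  shows "g i = h i"
proof -
  have rank: "card {x \<in> f ` {1..<t}. x < f i} = i - 1" if f: "strict_mono_on {1..<t} f" and i: "i \<in> {1..<t}"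
    for f :: "nat \<Rightarrow> nat" and i
  proof -
    have "f j < f i \<longleftrightarrow> j < i" if "j \<in> {1..<t}" for j
      using f i that by (simp add: strict_mono_on_less)
    then have "{x \<in> f ` {1..<t}. x < f i} = f ` {1..<i}" using i by auto
    moreover have "inj_on f {1..<i}"
      using strict_mono_on_imp_inj_on[OF f] by (rule inj_on_subset) (use i in auto)
    ultimately show ?thesis by (simp add: card_image)
  qed
  have "g i \<in> h ` {1..<t}" using im i by blast
  then obtain j where j: "j \<in> {1..<t}" "g i = h j" by auto
  have "i - 1 = j - 1" using rank[OF g i] rank[OF h j(1)] im j(2) by simp
  moreover have "1 \<le> i" "1 \<le> j" using i j(1) by auto
  ultimately have "i = j" by linarith
  then show ?thesis using j(2) by simp
qed

definition shapes :: "nat \<Rightarrow> (nat \<Rightarrow> nat) set" where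
  "shapes t = {p \<in> {1..<t} \<rightarrow>\<^sub>E {..<t}. (\<forall>i\<in>{1..<t}. p i < i) \<and> mono_on {1..<t} p}"

lemma finite_shapes: "finite (shapes t)"
  by (rule finite_subset[of _ "{1..<t} \<rightarrow>\<^sub>E {..<t}"]) (auto simp: shapes_def intro: finite_PiE)

text \<open>A shape \<open>p\<close> is determined by the image of the strictly increasing function \<open>i \<mapsto> p i + i\<close>.\<close>

lemma card_shapes: "real (card (shapes t)) \<le> 4 ^ t"
proof -
  define \<phi> where "\<phi> = (\<lambda>p. (\<lambda>i::nat. p i + i) ` {1..<t})"
  have "inj_on \<phi> (shapes t)"
  proof (rule inj_onI)
    fix p q assume pq: "p \<in> shapes t" "q \<in> shapes t" "\<phi> p = \<phi> q"
    have sm: "strict_mono_on {1..<t} (\<lambda>i. f i + i)" if "f \<in> shapes t" for f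
      using that by (auto simp: shapes_def strict_mono_on_def mono_on_def intro!: add_le_less_mono)
    show "p = q"
    proof (rule PiE_ext)
      show "p \<in> {1..<t} \<rightarrow>\<^sub>E {..<t}" "q \<in> {1..<t} \<rightarrow>\<^sub>E {..<t}" using pq by (auto simp: shapes_def)
      fix i assume "i \<in> {1..<t}"
      then show "p i = q i"
        using strict_mono_on_eq_if_image_eq[OF sm[OF pq(1)] sm[OF pq(2)]] pq(3) by (fastforce simp: \<phi>_def)
    qed
  qed
  moreover have "\<phi> ` shapes t \<subseteq> Pow {..<2 * t}"
    by (auto simp: \<phi>_def shapes_def PiE_iff)
  ultimately have "card (shapes t) \<le> card (Pow {..<2 * t})" by (rule card_inj_on_le) simp
  also have "\<dots> = 4 ^ t" by (simp add: card_Pow power_mult)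
  finally have "real (card (shapes t)) \<le> real (4 ^ t)" by (rule of_nat_mono)
  then show ?thesis by simp
qed

text \<open>The values are chosen in increasing order of the index. Since \<open>p i < i\<close>, a
  constrained index finds its parent's fibre already fixed and has only a share c of X to choose
  from.\<close>

lemma card_constrained_maps:
  fixes c :: real
  assumes X: "finite X" and p: "\<And>i. i \<in> S \<Longrightarrow> p i < i"
    and fib: "\<And>j. card {x \<in> X. \<pi> x = j} \<le> c * card X"
  shows "finite {v \<in> {..<t} \<rightarrow>\<^sub>E X. \<forall>i\<in>S. i < t \<longrightarrow> \<pi> (v (p i)) = \<pi> (v i)} \<and>
    card {v \<in> {..<t} \<rightarrow>\<^sub>E X. \<forall>i\<in>S. i < t \<longrightarrow> \<pi> (v (p i)) = \<pi> (v i)} \<le> real (card X) ^ t * c ^ card (S \<inter> {..<t})"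
proof (induction t)
  case 0
  have "{v \<in> {..<0::nat} \<rightarrow>\<^sub>E X. \<forall>i\<in>S. i < 0 \<longrightarrow> \<pi> (v (p i)) = \<pi> (v i)} = {\<lambda>_. undefined}" by auto
  then show ?case by simp
next
  case (Suc t)
  let ?N = "\<lambda>t. {v \<in> {..<t} \<rightarrow>\<^sub>E X. \<forall>i\<in>S. i < t \<longrightarrow> \<pi> (v (p i)) = \<pi> (v i)}"
  let ?B = "\<lambda>v. if t \<in> S then {x \<in> X. \<pi> x = \<pi> (v (p t))} else X"
  let ?f = "if t \<in> S then c else 1"
  have finN: "finite (?N t)" and cN: "card (?N t) \<le> real (card X) ^ t * c ^ card (S \<inter> {..<t})"
    using Suc by blast+
  have finB: "finite (?B v)" for v using X by simp
  have sub: "?N (Suc t) \<subseteq> (\<lambda>(v, x). v(t := x)) ` Sigma (?N t) ?B"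
  proof
    fix v assume v: "v \<in> ?N (Suc t)"
    let ?v = "restrict v {..<t}"
    have "?v \<in> ?N t"
    proof (intro CollectI conjI ballI impI)
      show "?v \<in> {..<t} \<rightarrow>\<^sub>E X" using v by auto
      fix i assume i: "i \<in> S" "i < t"
      then have "p i < t" using p less_trans by blast
      then show "\<pi> (?v (p i)) = \<pi> (?v i)" using v i by auto
    qed
    moreover have "v t \<in> ?B ?v" using v p[of t] by auto
    moreover have "v = ?v(t := v t)"
    proof
      fix i
      show "v i = (?v(t := v t)) i"
        using v by (cases "i < t"; cases "i = t") (auto simp: PiE_iff extensional_def)
    qed
    ultimately show "v \<in> (\<lambda>(v, x). v(t := x)) ` Sigma (?N t) ?B" by (intro image_eqI[of _ _ "(?v, v t)"]) auto
  qed
  have finS: "finite (Sigma (?N t) ?B)" using finN finB by (rule finite_SigmaI)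
  have "card (?N (Suc t)) \<le> card (Sigma (?N t) ?B)" by (rule surj_card_le[OF finS sub])
  also have "card (Sigma (?N t) ?B) = (\<Sum>v\<in>?N t. card (?B v))" using finN finB by (intro card_SigmaI) auto
  finally have "real (card (?N (Suc t))) \<le> real (\<Sum>v\<in>?N t. card (?B v))" by (rule of_nat_mono)
  also have "\<dots> = (\<Sum>v\<in>?N t. real (card (?B v)))" by (rule of_nat_sum)
  also have "\<dots> \<le> (\<Sum>v\<in>?N t. ?f * card X)" using fib by (intro sum_mono) auto
  also have "\<dots> = card (?N t) * (?f * card X)" by simp
  also have "\<dots> \<le> real (card X) ^ t * c ^ card (S \<inter> {..<t}) * (?f * card X)"
  proof (rule mult_right_mono[OF cN])
    \<comment> \<open>The sign of c is not given; \<open>fib\<close> bounds a cardinality, whatever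
      the fibre.\<close>
    have "0 \<le> c * card X" using fib[of "\<pi> undefined"] by linarith
    then show "0 \<le> ?f * card X" by simp
  qed
  also have "\<dots> = real (card X) ^ Suc t * c ^ card (S \<inter> {..<Suc t})"
  proof (cases "t \<in> S")
    case True
    then have "S \<inter> {..<Suc t} = insert t (S \<inter> {..<t})" by auto
    then show ?thesis using True by simp
  next
    case False
    then have "S \<inter> {..<Suc t} = S \<inter> {..<t}" by (auto simp: less_Suc_eq)
    then show ?thesis using False by simp
  qed
  finally show ?case using finite_subset[OF sub finite_imageI[OF finS]] by simp
qed

text \<open>Normalising v and p outside their index ranges makes the families in the union bounds
  finite.\<close>

lemma tree_code_restrict:
  assumes "tree_code t v p" "v ` {..<t} \<subseteq> X"
  obtains v' p' where "tree_code t v' p'" "v' \<in> {..<t} \<rightarrow>\<^sub>E X" "p' \<in> shapes t" "tree_arcs t v' p' = tree_arcs t v p"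
    "\<And>i. i < t \<Longrightarrow> v' i = v i" "\<And>i. i \<in> {1..<t} \<Longrightarrow> p' i = p i"
proof (rule that[of "restrict v {..<t}" "restrict p {1..<t}"])
  let ?v = "restrict v {..<t}" and ?p = "restrict p {1..<t}"
  have p: "p i < i" if "i \<in> {1..<t}" for i using assms(1) that by (auto simp: tree_code_def)
  have pt: "p i < t" if "i \<in> {1..<t}" for i using p[OF that] that by auto
  show tc: "tree_code t ?v ?p" using assms(1) by (auto simp: tree_code_def inj_on_def mono_on_def)
  show "?v \<in> {..<t} \<rightarrow>\<^sub>E X" using assms(2) by auto
  show "?p \<in> shapes t" using tc pt by (auto simp: shapes_def tree_code_def)
  show "tree_arcs t ?v ?p = tree_arcs t v p" unfolding tree_arcs_def
    by (rule image_cong) (use pt in auto)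
qed auto

text \<open>Union bound: at most 4^t shapes, 2^t sets S of inner edges, and for each the placements
  of the vertices, times (2 d / n)^(t - 1) for the tree to be present. An interval has a share of at
  most 1 / k^2, so half of the edges being inner leaves at most n^t / k^(t - 1) placements. One
  factor n survives, for the root.\<close>

lemma card_many_inner_tree:
  fixes k :: real
  assumes d: "d > 0" and n: "2 * (4 * d + 2 * (d * d) + 2 * t) \<le> n * d" and t: "1 \<le> t"
    and k: "1 \<le> k" and fib: "\<And>j. card {x \<in> {1..n}. \<pi> x = j} \<le> (1 / k\<^sup>2) * n"
  shows "card {A \<in> regular_rels n d. many_inner_tree {1..n} A \<pi> t}
    \<le> 8 ^ t * real n * (2 * real d / k) ^ (t - 1) * card (regular_rels n d)"
proof -
  have n0: "n > 0" using n t by (intro gr0I) simp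
  let ?R = "regular_rels n d"
  let ?V = "\<lambda>p S. {v \<in> {..<t} \<rightarrow>\<^sub>E {1..n}. \<forall>i\<in>S. i < t \<longrightarrow> \<pi> (v (p i)) = \<pi> (v i)}"
  let ?SS = "{S. S \<subseteq> {1..<t} \<and> t \<le> Suc (2 * card S)}"
  let ?B = "\<lambda>p v. {A \<in> ?R. tree_code t v p \<and> tree_arcs t v p \<subseteq> A}"
  have sub: "{A \<in> ?R. many_inner_tree {1..n} A \<pi> t} \<subseteq> (\<Union>p\<in>shapes t. \<Union>S\<in>?SS. \<Union>v\<in>?V p S. ?B p v)"
  proof
    fix A assume "A \<in> {A \<in> ?R. many_inner_tree {1..n} A \<pi> t}"
    then obtain v p where A: "A \<in> ?R" and vp: "tree_code t v p" "v ` {..<t} \<subseteq> {1..n}" "tree_arcs t v p \<subseteq> A"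
      "t \<le> Suc (2 * card {i\<in>{1..<t}. \<pi> (v (p i)) = \<pi> (v i)})" unfolding many_inner_tree_def by blast
    obtain v' p' where c: "tree_code t v' p'" "v' \<in> {..<t} \<rightarrow>\<^sub>E {1..n}" "p' \<in> shapes t"
      "tree_arcs t v' p' = tree_arcs t v p" "\<And>i. i < t \<Longrightarrow> v' i = v i" "\<And>i. i \<in> {1..<t} \<Longrightarrow> p' i = p i"
      using tree_code_restrict[OF vp(1,2)] by metis
    let ?S = "{i\<in>{1..<t}. \<pi> (v (p i)) = \<pi> (v i)}"
    have "\<pi> (v' (p' i)) = \<pi> (v' i)" if "i \<in> ?S" for i
    proof -
      have "p i < i" "i < t" "i \<in> {1..<t}" using vp(1) that by (auto simp: tree_code_def)
      then show ?thesis using that c(5)[of i] c(5)[of "p i"] c(6)[of i] by auto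
    qed
    then have "v' \<in> ?V p' ?S" using c(2) by blast
    moreover have "?S \<in> ?SS" using vp(4) by auto
    moreover have "A \<in> ?B p' v'" using A c vp(3) by simp
    ultimately show "A \<in> (\<Union>p\<in>shapes t. \<Union>S\<in>?SS. \<Union>v\<in>?V p S. ?B p v)" using c(3) by blast
  qed
  define q where "q = (2 * real d / n) ^ (t - 1) * card ?R"
  have q0: "q \<ge> 0" by (simp add: q_def)
  have B: "card (?B p v) \<le> q" for p v
  proof (cases "tree_code t v p")
    case True
    note F = tree_arcs_props[OF True]
    have "2 * (4 * d + 2 * (d * d) + 2 * card (tree_arcs t v p)) \<le> 2 * (4 * d + 2 * (d * d) + 2 * t)"
      unfolding F(2) by simp
    then have "2 * (4 * d + 2 * (d * d) + 2 * card (tree_arcs t v p)) \<le> n * d" using n by (rule order_trans)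
    from card_regular_rels_containing[OF F(3,4) d this] show ?thesis
      using True F(2) by (simp add: q_def)
  qed (simp add: q0)
  have V: "finite (?V p S)" "card (?V p S) \<le> real n ^ t * (1 / k) ^ (t - 1)" if p: "p \<in> shapes t" and S: "S \<in> ?SS" for p S
  proof -
    have pi: "p i < i" if "i \<in> S" for i using p S that by (auto simp: shapes_def)
    note * = card_constrained_maps[of "{1..n}" S p \<pi> "1 / k\<^sup>2" t, OF _ pi]
    show "finite (?V p S)" using * fib by simp
    have "card (?V p S) \<le> real n ^ t * (1 / k\<^sup>2) ^ card (S \<inter> {..<t})" using * fib by simp
    also have "S \<inter> {..<t} = S" using S by auto
    also have "(1 / k\<^sup>2) ^ card S = (1 / k) ^ (2 * card S)" by (simp add: power_mult power_divide)
    also have "\<dots> \<le> (1 / k) ^ (t - 1)" using S k by (intro power_decreasing) auto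
    finally show "card (?V p S) \<le> real n ^ t * (1 / k) ^ (t - 1)" by (simp add: mult_left_mono)
  qed
  have finSS: "finite ?SS" by (rule finite_subset[of _ "Pow {1..<t}"]) auto
  have "card ?SS \<le> card (Pow {1..<t})" by (rule card_mono) auto
  also have "\<dots> \<le> 2 ^ t" by (simp add: card_Pow power_increasing)
  finally have "card ?SS \<le> 2 ^ t" .
  then have "real (card ?SS) \<le> real (2 ^ t)" by (rule of_nat_mono)
  then have cSS: "real (card ?SS) \<le> 2 ^ t" by simp
  let ?nk = "real n ^ t * (1 / k) ^ (t - 1)"
  have nk: "?nk \<ge> 0" using k by simp
  have u1: "card (\<Union>v\<in>?V p S. ?B p v) \<le> ?nk * q" if "p \<in> shapes t" "S \<in> ?SS" for p S
    using order_trans[OF card_UN_le_mult[OF V(1)[OF that] B] mult_right_mono[OF V(2)[OF that] q0]] .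
  have u2: "card (\<Union>S\<in>?SS. \<Union>v\<in>?V p S. ?B p v) \<le> 2 ^ t * (?nk * q)" if "p \<in> shapes t" for p
    by (rule order_trans[OF card_UN_le_mult[OF finSS u1[OF that]] mult_right_mono[OF cSS]]) (use nk q0 in auto)
  have u3: "card (\<Union>p\<in>shapes t. \<Union>S\<in>?SS. \<Union>v\<in>?V p S. ?B p v) \<le> 4 ^ t * (2 ^ t * (?nk * q))"
    by (rule order_trans[OF card_UN_le_mult[OF finite_shapes u2] mult_right_mono[OF card_shapes]]) (use nk q0 in auto)
  have "card {A \<in> ?R. many_inner_tree {1..n} A \<pi> t} \<le> card (\<Union>p\<in>shapes t. \<Union>S\<in>?SS. \<Union>v\<in>?V p S. ?B p v)"
    by (rule card_mono[OF _ sub], rule finite_subset[OF _ finite_regular_rels[of n d]]) blast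
  then have "real (card {A \<in> ?R. many_inner_tree {1..n} A \<pi> t}) \<le> 4 ^ t * (2 ^ t * (?nk * q))"
    using u3 by linarith
  also have "\<dots> = 8 ^ t * real n * (2 * real d / k) ^ (t - 1) * card ?R"
  proof -
    have 8: "(8::real) ^ t = 4 ^ t * 2 ^ t" by (simp flip: power_mult_distrib)
    have nt: "real n ^ t = n * real n ^ (t - 1)" using t by (cases t) auto
    have "real n ^ (t - 1) * (1 / k) ^ (t - 1) * (2 * real d / n) ^ (t - 1) = (2 * real d / k) ^ (t - 1)"
      unfolding power_mult_distrib[symmetric] using n0 by simp
    then have "4 ^ t * 2 ^ t * real n * (2 * real d / k) ^ (t - 1) * card ?R =
      4 ^ t * 2 ^ t * real n * (real n ^ (t - 1) * (1 / k) ^ (t - 1) * (2 * real d / n) ^ (t - 1)) * card ?R"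
      by simp
    then show ?thesis unfolding q_def nt 8 by (simp only: mult_ac)
  qed
  finally show ?thesis .
qed

text \<open>Union bound over shapes, t^4 choices of ends for the two extra edges, and n^t
  placements. One edge more than vertices turns n^t (2 d / n)^(t + 1) into (2 d)^(t + 1) /
  n.\<close>

lemma card_bicyclic_tree:
  assumes d: "d > 0" and n: "2 * (4 * d + 2 * (d * d) + 2 * Suc t) \<le> n * d"
  shows "card {A \<in> regular_rels n d. bicyclic_tree {1..n} A t}
    \<le> 4 ^ t * real t ^ 4 * (2 * real d) ^ Suc t / real n * card (regular_rels n d)"
proof -
  have n0: "n > 0" using n by (intro gr0I) simp
  let ?R = "regular_rels n d"
  let ?V = "{..<t} \<rightarrow>\<^sub>E {1..n}"
  let ?J = "{..<t} \<times> {..<t} \<times> {..<t} \<times> {..<t}"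
  define F where "F = (\<lambda>p (v :: nat \<Rightarrow> nat) (a, b, a', b'). insert (v a, v b) (insert (v a', v b') (tree_arcs t v p)))"
  let ?B = "\<lambda>p v j. {A \<in> ?R. finite (F p v j) \<and> F p v j \<inter> (F p v j)\<inverse> = {} \<and> card (F p v j) = Suc t \<and> F p v j \<subseteq> A}"
  have sub: "{A \<in> ?R. bicyclic_tree {1..n} A t} \<subseteq> (\<Union>p\<in>shapes t. \<Union>v\<in>?V. \<Union>j\<in>?J. ?B p v j)"
  proof
    fix A assume "A \<in> {A \<in> ?R. bicyclic_tree {1..n} A t}"
    then have A: "A \<in> ?R" and "bicyclic_tree {1..n} A t" by simp_all
    then obtain v p a b a' b' where vp: "tree_code t v p" "v ` {..<t} \<subseteq> {1..n}"
      and ab: "a < t" "b < t" "a' < t" "b' < t"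
      and "let F = insert (v a, v b) (insert (v a', v b') (tree_arcs t v p)) in
        F \<subseteq> A \<and> F \<inter> F\<inverse> = {} \<and> card F = Suc t"
      unfolding bicyclic_tree_def by blast
    then have FA: "F p v (a, b, a', b') \<subseteq> A" "F p v (a, b, a', b') \<inter> (F p v (a, b, a', b'))\<inverse> = {}"
      "card (F p v (a, b, a', b')) = Suc t"
      by (simp_all add: F_def Let_def)
    obtain v' p' where c: "tree_code t v' p'" "v' \<in> ?V" "p' \<in> shapes t"
      "tree_arcs t v' p' = tree_arcs t v p" "\<And>i. i < t \<Longrightarrow> v' i = v i"
      using tree_code_restrict[OF vp(1,2)] by metis
    have eq: "F p' v' (a, b, a', b') = F p v (a, b, a', b')" using c ab by (simp add: F_def)
    have "finite (F p v (a, b, a', b'))" using FA(3) by (intro card_ge_0_finite) simp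
    then have AB: "A \<in> ?B p' v' (a, b, a', b')" using A FA eq by simp
    have J: "(a, b, a', b') \<in> ?J" using ab by simp
    show "A \<in> (\<Union>p\<in>shapes t. \<Union>v\<in>?V. \<Union>j\<in>?J. ?B p v j)"
      unfolding UN_iff by (rule bexI[OF _ c(3)], rule bexI[OF _ c(2)], rule bexI[OF _ J], rule AB)
  qed
  define q where "q = (2 * real d / n) ^ Suc t * card ?R"
  have q0: "q \<ge> 0" by (simp add: q_def)
  have B: "card (?B p v j) \<le> q" for p v j
  proof (cases "finite (F p v j) \<and> F p v j \<inter> (F p v j)\<inverse> = {} \<and> card (F p v j) = Suc t")
    case True
    have "2 * (4 * d + 2 * (d * d) + 2 * card (F p v j)) \<le> n * d" using n True by simp
    from card_regular_rels_containing[OF _ _ d this] show ?thesis using True by (simp add: q_def)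
  next
    case False
    then have empty: "?B p v j = {}" by blast
    show ?thesis unfolding empty using q0 by simp
  qed
  have cJ: "real (card ?J) = real t ^ 4" by (simp add: power4_eq_xxxx mult.assoc)
  have cV: "real (card ?V) = real n ^ t" by (simp add: card_PiE)
  have u1: "card (\<Union>j\<in>?J. ?B p v j) \<le> real t ^ 4 * q" for p v
    using card_UN_le_mult[of ?J "?B p v", OF _ B] unfolding cJ by simp
  have u2: "card (\<Union>v\<in>?V. \<Union>j\<in>?J. ?B p v j) \<le> real n ^ t * (real t ^ 4 * q)" for p
    using card_UN_le_mult[of ?V "\<lambda>v. \<Union>j\<in>?J. ?B p v j", OF _ u1] unfolding cV by (simp add: finite_PiE)
  have u3: "card (\<Union>p\<in>shapes t. \<Union>v\<in>?V. \<Union>j\<in>?J. ?B p v j) \<le> 4 ^ t * (real n ^ t * (real t ^ 4 * q))"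
    by (rule order_trans[OF card_UN_le_mult[OF finite_shapes u2] mult_right_mono[OF card_shapes]]) (use q0 in auto)
  have "card {A \<in> ?R. bicyclic_tree {1..n} A t} \<le> card (\<Union>p\<in>shapes t. \<Union>v\<in>?V. \<Union>j\<in>?J. ?B p v j)"
    by (rule card_mono[OF _ sub], rule finite_subset[OF _ finite_regular_rels[of n d]]) blast
  then have "real (card {A \<in> ?R. bicyclic_tree {1..n} A t}) \<le> 4 ^ t * (real n ^ t * (real t ^ 4 * q))"
    using u3 by linarith
  also have "\<dots> = 4 ^ t * real t ^ 4 * (2 * real d) ^ Suc t / real n * card ?R"
  proof -
    have e: "real n ^ t * (2 * real d / n) ^ Suc t = (2 * real d) ^ Suc t / n"
      using n0 by (simp add: power_divide)
    have "4 ^ t * real t ^ 4 * ((2 * real d) ^ Suc t / n) * card ?R =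
      4 ^ t * real t ^ 4 * (real n ^ t * (2 * real d / n) ^ Suc t) * card ?R" by (simp only: e)
    then show ?thesis unfolding q_def times_divide_eq_right[symmetric] by (simp only: mult_ac)
  qed
  finally show ?thesis .
qed

section \<open>Existence of regular graphs\<close>

text \<open>The Cayley graph of the integers modulo n for a connection set S closed under negation.
  The alternative \<open>y + n = x + s\<close> is the wrap-around, written without
  subtraction.\<close>

lemma circulant_regular:
  assumes S: "S \<subseteq> {1..<n}" "card S = d" and sym: "\<And>s. s \<in> S \<Longrightarrow> n - s \<in> S"
  shows "{(x, y). x \<in> {1..n} \<and> y \<in> {1..n} \<and> (\<exists>s\<in>S. y = x + s \<or> y + n = x + s)} \<in> regular_rels n d"
proof -
  let ?A = "{(x, y). x \<in> {1..n} \<and> y \<in> {1..n} \<and> (\<exists>s\<in>S. y = x + s \<or> y + n = x + s)}"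
  have lt: "1 \<le> s \<and> s < n" if "s \<in> S" for s using S that by auto
  have "(y, x) \<in> ?A" if "(x, y) \<in> ?A" for x y
  proof -
    have "\<exists>s\<in>S. y = x + s \<or> y + n = x + s" using that by simp
    then obtain s where s: "s \<in> S" "y = x + s \<or> y + n = x + s" by blast
    then have "x = y + (n - s) \<or> x + n = y + (n - s)" using lt[of s] by linarith
    then show ?thesis using sym[OF s(1)] that by auto
  qed
  then have "Relation.sym ?A" by (auto simp: sym_def)
  moreover have "(x, x) \<notin> ?A" for x using lt by fastforce
  moreover have "card (?A `` {x}) = d" if x: "x \<in> {1..n}" for x
  proof -
    let ?f = "\<lambda>s. if x + s \<le> n then x + s else x + s - n"
    have "?A `` {x} = ?f ` S"
    proof
      show "?A `` {x} \<subseteq> ?f ` S"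
      proof
        fix y assume "y \<in> ?A `` {x}"
        then have "y \<in> {1..n}" "\<exists>s\<in>S. y = x + s \<or> y + n = x + s" by simp_all
        then obtain s where "s \<in> S" "y \<in> {1..n}" "y = x + s \<or> y + n = x + s" by blast
        then show "y \<in> ?f ` S" by (intro image_eqI[of _ _ s]) auto
      qed
      show "?f ` S \<subseteq> ?A `` {x}"
      proof
        fix y assume "y \<in> ?f ` S"
        then obtain s where s: "s \<in> S" "y = ?f s" by blast
        then have "y = x + s \<or> y + n = x + s" "y \<in> {1..n}" using lt[OF s(1)] x by (auto split: if_splits)
        then show "y \<in> ?A `` {x}" using s(1) x by auto
      qed
    qed
    moreover have "inj_on ?f S"
    proof (rule inj_onI)
      fix s s' assume "s \<in> S" "s' \<in> S" "?f s = ?f s'"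
      then show "s = s'" using lt[of s] lt[of s'] x by (auto split: if_splits)
    qed
    ultimately show ?thesis using S(2) by (simp only: card_image)
  qed
  ultimately show ?thesis unfolding regular_rels_def by blast
qed

text \<open>The differences up to \<open>d div 2\<close> in both directions give an even degree; for
  odd d the number n is even, and n / 2, its own negative, supplies the missing neighbour. This
  makes the uniform distribution meaningful.\<close>

lemma regular_rels_nonempty:
  assumes "d < n" "even (n * d)"
  shows "regular_rels n d \<noteq> {}"
proof -
  define k where "k = d div 2"
  let ?S = "{1..k} \<union> {n - k..<n}"
  have k: "2 * k \<le> d" "k < n - k" using assms(1) by (auto simp: k_def)
  have cS: "card ?S = 2 * k" using k by (subst card_Un_disjoint) auto
  have flip: "n - s \<in> ?S" if "s \<in> ?S" for s using that k by auto
  show ?thesis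
  proof (cases "even d")
    case True
    then have "card ?S = d" using cS by (simp add: k_def)
    then show ?thesis using circulant_regular[of ?S n d] k flip by fastforce
  next
    case False
    then obtain m where m: "n = 2 * m" using assms(2) by auto
    have d: "d = 2 * k + 1" using False by (simp add: k_def odd_two_times_div_two_succ)
    let ?T = "insert m ?S"
    have "m \<notin> ?S" using assms(1) m d by auto
    then have "card ?T = d" using cS d by simp
    moreover have "?T \<subseteq> {1..<n}" using assms(1) m d by auto
    moreover have "n - s \<in> ?T" if "s \<in> ?T" for s
      using that flip[of s] m by auto
    ultimately show ?thesis using circulant_regular[of ?T n d] by blast
  qed
qed

section \<open>The Ramsey bound and its probability\<close>

text \<open>What matters is the order of quantifiers: C depends on d and l only. The width
  \<open>n div 2 ^ l + 1\<close> makes the interval numbers of 1, ..., n stay below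
  \<open>2 ^ l\<close>.\<close>

lemma oriented_ramsey_upwards_le:
  assumes d: "2 \<le> d"
  obtains C :: real where "C > 0"
    "\<And>n t A N. A \<in> regular_rels n d \<Longrightarrow> 1 \<le> n \<Longrightarrow> 2 ^ t \<le> n \<Longrightarrow>
       peelable d t {1..n} {(x, y) \<in> A. x < y} (\<lambda>x. x div (n div 2 ^ l + 1)) \<Longrightarrow> C * real n \<le> real N \<Longrightarrow>
       oriented_ramsey (orient_upwards \<lparr>pverts = {1..n}, parcs = A\<rparr>) \<le> N"
proof -
  have "1 / (4 * real d) > 0" using d by simp
  from embeds_or_dominating_chain[OF this, of d l]
  obtain c C1 :: real where c: "c > 0" and C1: "C1 > 0" and
    chain: "\<And>(X :: nat set) E (U :: nat set) R. host d C1 X E U R \<Longrightarrow> \<not> embeds X E U R \<Longrightarrow>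
      (\<exists>V :: nat \<Rightarrow> nat set. (\<forall>i<2 ^ l. V i \<subseteq> U \<and> c * card U \<le> card (V i)) \<and>
         (\<forall>j<2 ^ l. \<forall>i<j. dominates R (1 / (4 * real d)) (V i) (V j)))" by blast
  \<comment> \<open>The term \<open>3 / c\<close> makes every set of the chain at least 3 n large: n
    for occupied vertices, at most n for \<open>2 ^ t\<close>, and a quarter of the set for the d
    edges at \<eta> = 1 / (4 d).\<close>
  show thesis
  proof (rule that[of "max C1 (3 / c)"])
    show "max C1 (3 / c) > 0" using C1 by simp
    fix n t A N
    assume A: "A \<in> regular_rels n d" and n1: "1 \<le> n" and t: "2 ^ t \<le> n" and N: "max C1 (3 / c) * real n \<le> real N"
      and peel: "peelable d t {1..n} {(x, y) \<in> A. x < y} (\<lambda>x. x div (n div 2 ^ l + 1))"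
    note a = regular_relsD[OF A]
    let ?E = "{(x, y) \<in> A. x < y}"
    have "C1 * n \<le> max C1 (3 / c) * n" "3 / c * n \<le> max C1 (3 / c) * n"
      by (intro mult_right_mono; simp)+
    then have CN: "C1 * n \<le> N" "3 / c * n \<le> N" using N by linarith+
    have cN: "3 * n \<le> c * N" using CN(2) c by (simp add: field_simps)
    have "contains_copy T (orient_upwards \<lparr>pverts = {1..n}, parcs = A\<rparr>)"
      if T: "tournament T" "card (pverts T) = N" for T :: "nat pair_pre_digraph"
    proof -
      have "pair_digraph T" using T(1) by (simp add: tournament_def)
      then interpret pair_digraph T .
      have U: "finite (pverts T)" by (rule pair_finite_verts)
      have to: "tournament_on (pverts T) (parcs T)"
        using T(1) unfolding tournament_def tournament_on_def by blast
      have "card (nbrs ?E x \<inter> {1..n}) \<le> d" for x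
      proof -
        have "nbrs ?E x \<inter> {1..n} \<subseteq> A `` {x}" using a(3) by (auto simp: nbrs_def)
        then have "card (nbrs ?E x \<inter> {1..n}) \<le> card (A `` {x})" using a(6) by (intro card_mono)
        then show ?thesis using a(7)[of x] by linarith
      qed
      then have h: "host d C1 {1..n} ?E (pverts T) (parcs T)"
        using U to CN(1) T(2) by (auto simp: host_def)
      have "embeds {1..n} ?E (pverts T) (parcs T)"
      proof (rule ccontr)
        assume ne: "\<not> embeds {1..n} ?E (pverts T) (parcs T)"
        from chain[OF h ne] obtain V :: "nat \<Rightarrow> nat set" where
          V: "\<forall>i<2 ^ l. V i \<subseteq> pverts T \<and> c * card (pverts T) \<le> card (V i)"
          "\<forall>j<2 ^ l. \<forall>i<j. dominates (parcs T) (1 / (4 * real d)) (V i) (V j)"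
          by (elim exE conjE)
        have "embeds {1..n} ?E (pverts T) (parcs T)"
        proof (rule embeds_into_chain[OF _ _ _ _ peel U to, where V = V and K = "2 ^ l" and \<eta> = "1 / (4 * real d)"])
          show "finite {1..n}" "\<And>x y. (x, y) \<in> ?E \<Longrightarrow> x < y" "0 \<le> 1 / (4 * real d)" by auto
          show "x div (n div 2 ^ l + 1) \<le> y div (n div 2 ^ l + 1)" if "(x, y) \<in> ?E" for x y
            using that by (intro div_le_mono) auto
          show "x div (n div 2 ^ l + 1) < 2 ^ l" if "x \<in> {1..n}" for x
          proof -
            have "n < 2 ^ l * (n div 2 ^ l + 1)"
              using dividend_less_div_times[of "2 ^ l" n] by (simp add: algebra_simps)
            then have "x < 2 ^ l * (n div 2 ^ l + 1)" using that by auto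
            then show ?thesis by (rule less_mult_imp_div_less)
          qed
          show "V i \<subseteq> pverts T" if "i < 2 ^ l" for i using V(1) that by blast
          show "dominates (parcs T) (1 / (4 * real d)) (V i) (V j)" if "j < 2 ^ l" "i < j" for i j
            using V(2) that by blast
          show "real (card {1..n}) + 2 ^ t + d * (1 / (4 * real d) * card (V i)) \<le> card (V i)"
            if "i < 2 ^ l" for i
          proof -
            have "3 * real n \<le> card (V i)" using cN V(1) that T(2) by fastforce
            moreover have eq: "d * (1 / (4 * real d) * card (V i)) = card (V i) / 4" using d by simp
            moreover have "(2::real) ^ t \<le> n" using of_nat_mono[where 'a = real, OF t] by simp
            moreover have cn: "card {1..n} = n" by simp
            ultimately show ?thesis unfolding eq cn by linarith
          qed
        qed
        with ne show False by blast
      qed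
      then obtain f where "inj_on f {1..n}" "f ` {1..n} \<subseteq> pverts T"
        "\<forall>x\<in>{1..n}. \<forall>y\<in>{1..n}. (x, y) \<in> ?E \<longrightarrow> (f x, f y) \<in> parcs T" unfolding embeds_def by blast
      then show ?thesis unfolding contains_copy_def orient_upwards_def using a(1)
        by (intro exI[of _ f]) auto
    qed
    then show "oriented_ramsey (orient_upwards \<lparr>pverts = {1..n}, parcs = A\<rparr>) \<le> N"
      unfolding oriented_ramsey_def by (intro Least_le) blast
  qed
qed

lemma card_div_fiber_le: "card {x \<in> {1..n}. x div (w + 1) = j} \<le> w + 1" for w :: nat
proof -
  have "{x \<in> {1..n}. x div (w + 1) = j} \<subseteq> {j * (w + 1)..<j * (w + 1) + (w + 1)}"
  proof
    fix x assume "x \<in> {x \<in> {1..n}. x div (w + 1) = j}"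
    then have "j = x div (w + 1)" by simp
    then show "x \<in> {j * (w + 1)..<j * (w + 1) + (w + 1)}"
      using div_times_less_eq_dividend[of x "w + 1"] dividend_less_div_times[of "w + 1" x] by simp
  qed
  then have "card {x \<in> {1..n}. x div (w + 1) = j} \<le> card {j * (w + 1)..<j * (w + 1) + (w + 1)}"
    by (intro card_mono) auto
  then show ?thesis by simp
qed

text \<open>The first error term comes from trees of size t and t + 1 with many inner edges, the
  second from bicyclic subgraphs of all sizes up to t; summing over these sizes raises t^4 to
  t^5.\<close>

lemma card_not_peelable:
  assumes d: "2 \<le> d" and b: "16 * d \<le> 2 ^ b" and t: "1 \<le> t"
    and n: "2 ^ (2 * b * t) \<le> n" "n < 2 ^ (2 * b * (t + 1))" "2 ^ (10 * b + 1) \<le> n"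
    and cond: "2 * (4 * d + 2 * (d * d) + 2 * Suc t) \<le> n * d"
  shows "card {A \<in> regular_rels n d. \<not> peelable d t {1..n} {(x, y) \<in> A. x < y} (\<lambda>x. x div (n div 2 ^ (10 * b + 1) + 1))}
    \<le> (16 * 2 ^ (8 * b) / real n + 2 * real d * real t ^ 5 / sqrt (real n)) * card (regular_rels n d)"
proof -
  let ?R = "regular_rels n d"
  define \<pi> where "\<pi> = (\<lambda>x. x div (n div 2 ^ (10 * b + 1) + 1))"
  have n0: "n > 0" using n(1) by (metis less_le_trans zero_less_numeral zero_less_power)
  define k :: real where "k = 2 ^ (5 * b)"
  have k: "1 \<le> k" by (simp add: k_def)
  have k2: "2 * k\<^sup>2 = 2 ^ (10 * b + 1)" by (simp add: k_def flip: power_mult)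
  \<comment> \<open>With \<open>2 * k\<^sup>2\<close> intervals the expected share is half of what
    is allowed; the other half absorbs the rounding, as n is at least the number of
    intervals.\<close>
  have fib: "card {x \<in> {1..n}. \<pi> x = j} \<le> (1 / k\<^sup>2) * n" for j
  proof -
    have "real (n div 2 ^ (10 * b + 1)) \<le> n / (2 * k\<^sup>2)"
      unfolding k2 using of_nat_div_le_of_nat[where 'a = real, of n "2 ^ (10 * b + 1)"] by simp
    moreover have "2 * k\<^sup>2 \<le> n" unfolding k2 using of_nat_mono[where 'a = real, OF n(3)] by simp
    then have "1 \<le> n / (2 * k\<^sup>2)" using k by (simp add: field_simps)
    moreover have "real (card {x \<in> {1..n}. \<pi> x = j}) \<le> real (n div 2 ^ (10 * b + 1)) + 1"
      using of_nat_mono[where 'a = real, OF card_div_fiber_le[of n "n div 2 ^ (10 * b + 1)" j]] unfolding \<pi>_def by simp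
    ultimately have "real (card {x \<in> {1..n}. \<pi> x = j}) \<le> n / (2 * k\<^sup>2) + n / (2 * k\<^sup>2)" by linarith
    also have "\<dots> = (1 / k\<^sup>2) * n" using k by (simp add: field_simps)
    finally show ?thesis .
  qed
  have rb: "16 * real d \<le> 2 ^ b" using of_nat_mono[where 'a = real, OF b] by simp
  have rn: "(2::real) ^ (2 * b * t) \<le> n" "real n \<le> 2 ^ (2 * b * (t + 1))"
    using of_nat_mono[where 'a = real, OF n(1)] of_nat_mono[where 'a = real, OF less_imp_le[OF n(2)]] by simp_all
  \<comment> \<open>Since \<open>n < 2 ^ (2 * b * (t + 1))\<close>, the square of n is at most 2^(4
    b (t - 1)) up to the constant 2^(8 b). One n cancels the choice of the root, the other makes the
    bound tend to 0.\<close>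
  have small: "(1 / 2 ^ (4 * b)) ^ (t - 1) \<le> 2 ^ (8 * b) / (real n)\<^sup>2"
  proof -
    have "(real n)\<^sup>2 \<le> (2 ^ (2 * b * (t + 1)))\<^sup>2" using rn(2) by (intro power_mono) auto
    also have "\<dots> = 2 ^ (4 * b * (t - 1) + 8 * b)" using t
      by (cases t) (auto simp: algebra_simps simp flip: power_mult power_add)
    finally have "(real n)\<^sup>2 \<le> (2 ^ (4 * b)) ^ (t - 1) * 2 ^ (8 * b)" by (simp add: power_add power_mult)
    then show ?thesis using n0 by (simp add: power_divide field_simps)
  qed
  have many: "card {A \<in> ?R. many_inner_tree {1..n} A \<pi> s} \<le> 8 * 2 ^ (8 * b) / real n * card ?R"
    if s: "t \<le> s" "s \<le> Suc t" for s
  proof -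
    have "2 * (4 * d + 2 * (d * d) + 2 * s) \<le> 2 * (4 * d + 2 * (d * d) + 2 * Suc t)" using s by simp
    then have "2 * (4 * d + 2 * (d * d) + 2 * s) \<le> n * d" using cond by (rule order_trans)
    then have "card {A \<in> ?R. many_inner_tree {1..n} A \<pi> s} \<le> 8 ^ s * real n * (2 * real d / k) ^ (s - 1) * card ?R"
      using card_many_inner_tree[of d s n k \<pi>] d t s k fib by simp
    also have "8 ^ s * real n * (2 * real d / k) ^ (s - 1) \<le> 8 * 2 ^ (8 * b) / real n"
    proof -
      have "(8::real) ^ s = 8 * 8 ^ (s - 1)" using s t by (cases s) auto
      then have "8 ^ s * real n * (2 * real d / k) ^ (s - 1) = 8 * n * (8 * (2 * real d / k)) ^ (s - 1)"
        by (simp only: power_mult_distrib mult_ac)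
      \<comment> \<open>This is what k = 2^(5 b) is for: 2^b pays for 16 d, the constants per edge,
        and 2^(4 b) remains.\<close>
      also have "8 * (2 * real d / k) \<le> 1 / 2 ^ (4 * b)"
      proof -
        have "k = 2 ^ b * 2 ^ (4 * b)" by (simp add: k_def flip: power_add)
        then show ?thesis using rb by (simp add: field_simps)
      qed
      then have "8 * n * (8 * (2 * real d / k)) ^ (s - 1) \<le> 8 * n * (1 / 2 ^ (4 * b)) ^ (s - 1)"
        using k by (intro mult_left_mono power_mono) auto
      also have "\<dots> \<le> 8 * n * (1 / 2 ^ (4 * b)) ^ (t - 1)"
        using s by (intro mult_left_mono power_decreasing) auto
      also have "\<dots> \<le> 8 * n * (2 ^ (8 * b) / (real n)\<^sup>2)" using small by (intro mult_left_mono) auto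
      also have "\<dots> = 8 * 2 ^ (8 * b) / real n" using n0 by (simp add: power2_eq_square)
      finally show ?thesis .
    qed
    finally show ?thesis by (simp add: mult_right_mono)
  qed
  have bi: "card {A \<in> ?R. bicyclic_tree {1..n} A s} \<le> 2 * real d * real t ^ 4 / sqrt n * card ?R"
    if s: "s \<in> {1..t}" for s
  proof -
    have "2 * (4 * d + 2 * (d * d) + 2 * Suc s) \<le> 2 * (4 * d + 2 * (d * d) + 2 * Suc t)" using s by simp
    then have "2 * (4 * d + 2 * (d * d) + 2 * Suc s) \<le> n * d" using cond by (rule order_trans)
    then have "card {A \<in> ?R. bicyclic_tree {1..n} A s} \<le> 4 ^ s * real s ^ 4 * (2 * real d) ^ Suc s / real n * card ?R"
      using card_bicyclic_tree[of d s n] d by simp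
    also have "4 ^ s * real s ^ 4 * (2 * real d) ^ Suc s / real n \<le> 2 * real d * real t ^ 4 / sqrt n"
    proof -
      \<comment> \<open>The lower bound \<open>2 ^ (2 * b * t) \<le> n\<close> enters here: the
        exponential factor stays below sqrt n, so 1 / sqrt n is left of 1 / n.\<close>
      have "4 ^ s * (2 * real d) ^ s = (4 * (2 * real d)) ^ s" by (simp only: power_mult_distrib)
      also have "\<dots> \<le> (2 ^ b) ^ s" using rb by (intro power_mono) auto
      also have "\<dots> \<le> (2 ^ b) ^ t" using s by (intro power_increasing) auto
      also have "\<dots> \<le> sqrt n"
      proof (rule real_le_rsqrt)
        show "((2 ^ b) ^ t)\<^sup>2 \<le> real n" using rn(1) by (simp add: mult_ac flip: power_mult)
      qed
      finally have 1: "4 ^ s * (2 * real d) ^ s \<le> sqrt n" .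
      have 2: "real s ^ 4 \<le> real t ^ 4" using s by (intro power_mono) auto
      have "4 ^ s * real s ^ 4 * (2 * real d) ^ Suc s = (2 * real d) * (real s ^ 4 * (4 ^ s * (2 * real d) ^ s))"
        by (simp add: mult_ac)
      also have "\<dots> \<le> (2 * real d) * (real t ^ 4 * sqrt n)"
        using 1 2 by (intro mult_left_mono mult_mono) auto
      finally have "4 ^ s * real s ^ 4 * (2 * real d) ^ Suc s / real n \<le> (2 * real d) * (real t ^ 4 * sqrt n) / real n"
        by (intro divide_right_mono) auto
      also have "\<dots> = 2 * real d * real t ^ 4 * (sqrt n / real n)" by simp
      also have "sqrt n / real n = 1 / sqrt n" using n0 by (simp add: field_simps)
      finally show ?thesis by simp
    qed
    finally show ?thesis by (simp add: mult_right_mono)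
  qed
  let ?M = "\<lambda>s. {A \<in> ?R. many_inner_tree {1..n} A \<pi> s}" and ?B = "\<lambda>s. {A \<in> ?R. bicyclic_tree {1..n} A s}"
  have "{A \<in> ?R. \<not> peelable d t {1..n} {(x, y) \<in> A. x < y} \<pi>} \<subseteq> ?M t \<union> ?M (Suc t) \<union> (\<Union>s\<in>{1..t}. ?B s)"
  proof
    fix A assume "A \<in> {A \<in> ?R. \<not> peelable d t {1..n} {(x, y) \<in> A. x < y} \<pi>}"
    then have A: "A \<in> ?R" and np: "\<not> peelable d t {1..n} {(x, y) \<in> A. x < y} \<pi>" by simp_all
    show "A \<in> ?M t \<union> ?M (Suc t) \<union> (\<Union>s\<in>{1..t}. ?B s)"
    proof (rule ccontr)
      assume no: "A \<notin> ?M t \<union> ?M (Suc t) \<union> (\<Union>s\<in>{1..t}. ?B s)"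
      have "peelable d t {1..n} {(x, y) \<in> A. x < y} \<pi>"
      proof (rule peelable_if_locally_sparse)
        show "sym A" "A \<subseteq> {1..n} \<times> {1..n}" "\<And>x. (x, x) \<notin> A" using A by (auto simp: regular_rels_def)
        show "card (A `` {x}) \<le> d" for x using regular_relsD(7)[OF A] .
        show "\<not> many_inner_tree {1..n} A \<pi> t" "\<not> many_inner_tree {1..n} A \<pi> (Suc t)" using no A by auto
        show "\<not> bicyclic_tree {1..n} A s" if "1 \<le> s" "s \<le> t" for s using no A that by auto
      qed (use d t in auto)
      then show False using np by blast
    qed
  qed
  then have "card {A \<in> ?R. \<not> peelable d t {1..n} {(x, y) \<in> A. x < y} \<pi>} \<le> card (?M t \<union> ?M (Suc t) \<union> (\<Union>s\<in>{1..t}. ?B s))"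
    by (rule card_mono[rotated], intro finite_subset[OF _ finite_regular_rels[of n d]]) blast
  also have "\<dots> \<le> card (?M t) + card (?M (Suc t)) + card (\<Union>s\<in>{1..t}. ?B s)"
    by (rule order_trans[OF card_Un_le add_right_mono]) (rule card_Un_le)
  finally have "real (card {A \<in> ?R. \<not> peelable d t {1..n} {(x, y) \<in> A. x < y} \<pi>})
      \<le> card (?M t) + card (?M (Suc t)) + real (card (\<Union>s\<in>{1..t}. ?B s))" by linarith
  also have "\<dots> \<le> 8 * 2 ^ (8 * b) / real n * card ?R + 8 * 2 ^ (8 * b) / real n * card ?R +
      t * (2 * real d * real t ^ 4 / sqrt n * card ?R)"
  proof -
    have "real (card (\<Union>s\<in>{1..t}. ?B s)) \<le> card {1..t} * (2 * real d * real t ^ 4 / sqrt n * card ?R)"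
      by (rule card_UN_le_mult) (use bi in auto)
    moreover have "card {1..t} = t" by simp
    ultimately have "real (card (\<Union>s\<in>{1..t}. ?B s)) \<le> t * (2 * real d * real t ^ 4 / sqrt n * card ?R)"
      by (simp only:)
    then show ?thesis unfolding of_nat_add
      by (rule add_mono[OF add_mono[OF many[OF order_refl le_SucI[OF order_refl]]
            many[OF le_SucI[OF order_refl] order_refl]]])
  qed
  also have "\<dots> = (16 * 2 ^ (8 * b) / real n + 2 * real d * real t ^ 5 / sqrt (real n)) * card ?R"
  proof -
    have "real t ^ 5 = t * real t ^ 4" by (simp add: numeral_eq_Suc)
    then show ?thesis by (simp add: algebra_simps)
  qed
  finally show ?thesis unfolding \<pi>_def .
qed

lemma regular_graphs_eq: "regular_graphs n d = (\<lambda>A. \<lparr>pverts = {1..n}, parcs = A\<rparr>) ` regular_rels n d"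
proof
  have deg: "out_degree (with_proj G) v = card (parcs G `` {v})" for G :: "nat pair_pre_digraph" and v
  proof -
    have "out_arcs (with_proj G) v = Pair v ` (parcs G `` {v})" by (auto simp: out_arcs_def)
    then show ?thesis by (simp add: out_degree_def card_image inj_on_def)
  qed
  show "regular_graphs n d \<subseteq> (\<lambda>A. \<lparr>pverts = {1..n}, parcs = A\<rparr>) ` regular_rels n d"
  proof
    fix G assume G: "G \<in> regular_graphs n d"
    then have "pair_graph G" and V: "pverts G = {1..n}" and dg: "\<forall>v\<in>{1..n}. card (parcs G `` {v}) = d"
      by (auto simp: regular_graphs_def deg)
    then interpret pair_graph G by blast
    have "parcs G \<subseteq> {1..n} \<times> {1..n}" using in_arcsD1 in_arcsD2 V by fastforce
    moreover have "sym (parcs G)" using pair_sym_arcs by (simp add: symmetric_def)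
    moreover have "(x, x) \<notin> parcs G" for x using pair_no_loops by fastforce
    ultimately have "parcs G \<in> regular_rels n d" using dg by (auto simp: regular_rels_def)
    moreover have "G = \<lparr>pverts = {1..n}, parcs = parcs G\<rparr>" using V by simp
    ultimately show "G \<in> (\<lambda>A. \<lparr>pverts = {1..n}, parcs = A\<rparr>) ` regular_rels n d" by blast
  qed
  show "(\<lambda>A. \<lparr>pverts = {1..n}, parcs = A\<rparr>) ` regular_rels n d \<subseteq> regular_graphs n d"
  proof
    fix G assume "G \<in> (\<lambda>A. \<lparr>pverts = {1..n}, parcs = A\<rparr>) ` regular_rels n d"
    then obtain A where A: "A \<in> regular_rels n d" and G: "G = \<lparr>pverts = {1..n}, parcs = A\<rparr>" by blast
    note a = regular_relsD[OF A]
    have "pair_graph G"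
    proof
      show "fst e \<in> pverts G" "snd e \<in> pverts G" if "e \<in> parcs G" for e using that a(1) by (auto simp: G)
      show "finite (pverts G)" "finite (parcs G)" using a(2) by (auto simp: G)
      show "fst e \<noteq> snd e" if "e \<in> parcs G" for e using that a(4) by (cases e) (auto simp: G)
      show "symmetric (with_proj G)" using A by (simp add: symmetric_def G regular_rels_def)
    qed
    then show "G \<in> regular_graphs n d" using a(5) by (simp add: regular_graphs_def deg G)
  qed
qed

text \<open>Pulling Q back along \<open>orient_upwards\<close> leaves a proportion of undirected
  regular graphs.\<close>

lemma prob_random_regular_digraph_ge:
  fixes \<epsilon> :: real
  assumes ne: "regular_rels n d \<noteq> {}"
    and bad: "card {A \<in> regular_rels n d. \<not> P A} \<le> \<epsilon> * card (regular_rels n d)"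
    and good: "\<And>A. A \<in> regular_rels n d \<Longrightarrow> P A \<Longrightarrow> orient_upwards \<lparr>pverts = {1..n}, parcs = A\<rparr> \<in> Q"
  shows "1 - \<epsilon> \<le> measure_pmf.prob (random_regular_digraph n d) Q"
proof -
  let ?R = "regular_rels n d" and ?g = "\<lambda>A. \<lparr>pverts = {1..n}, parcs = A\<rparr>"
  have inj: "inj_on ?g S" for S by (auto simp: inj_on_def)
  have fin: "finite ?R" by (rule finite_regular_rels)
  have R0: "real (card ?R) > 0" using ne fin by (simp add: card_gt_0_iff)
  have fG: "finite (regular_graphs n d)" "regular_graphs n d \<noteq> {}" using fin ne by (auto simp: regular_graphs_eq)
  have cG: "card (regular_graphs n d) = card ?R" unfolding regular_graphs_eq using inj by (rule card_image)
  have "card ?R = card {A \<in> ?R. P A} + card {A \<in> ?R. \<not> P A}"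
  proof -
    have "?R = {A \<in> ?R. P A} \<union> {A \<in> ?R. \<not> P A}" by blast
    moreover have "{A \<in> ?R. P A} \<inter> {A \<in> ?R. \<not> P A} = {}" by blast
    ultimately show ?thesis using fin by (metis (no_types, lifting) card_Un_disjoint finite_Un)
  qed
  then have "(1 - \<epsilon>) * card ?R \<le> card {A \<in> ?R. P A}" using bad by (simp add: algebra_simps)
  also have "card {A \<in> ?R. P A} = card (?g ` {A \<in> ?R. P A})" using inj by (rule card_image[symmetric])
  also have "\<dots> \<le> card (regular_graphs n d \<inter> orient_upwards -` Q)"
    using fG good by (intro card_mono) (auto simp: regular_graphs_eq)
  finally have "1 - \<epsilon> \<le> card (regular_graphs n d \<inter> orient_upwards -` Q) / card (regular_graphs n d)"
    using R0 by (simp add: cG field_simps)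
  then show ?thesis
    unfolding random_regular_digraph_def random_regular_graph_def measure_map_pmf measure_pmf_of_set[OF fG(2,1)] .
qed

theorem theorem1p3:
  fixes d :: nat
  assumes "d \<ge> 2"
  shows "((\<lambda>n. measure_pmf.prob (random_regular_digraph n d)
             {H. real (oriented_ramsey H) \<le> real n * log 2 (real n) powr (4 * log 2 (real d))})
           \<longlongrightarrow> 1) (inf sequentially (principal {n. even (n * d)}))"
proof -
  define b where "b = 16 * d"
  have b: "16 * d \<le> 2 ^ b" unfolding b_def by (rule less_imp_le[OF less_exp])
  obtain C :: real where "C > 0" and ramsey:
    "\<And>n t A N. A \<in> regular_rels n d \<Longrightarrow> 1 \<le> n \<Longrightarrow> 2 ^ t \<le> n \<Longrightarrow>
       peelable d t {1..n} {(x, y) \<in> A. x < y} (\<lambda>x. x div (n div 2 ^ (10 * b + 1) + 1)) \<Longrightarrow> C * real n \<le> real N \<Longrightarrow>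
       oriented_ramsey (orient_upwards \<lparr>pverts = {1..n}, parcs = A\<rparr>) \<le> N"
    using oriented_ramsey_upwards_le[OF assms, of "10 * b + 1"] by blast
  define bound where "bound = (\<lambda>n. real n * log 2 (real n) powr (4 * log 2 (real d)))"
  define \<epsilon> where "\<epsilon> = (\<lambda>n. 16 * 2 ^ (8 * b) / real n + 2 * real d * log 2 (real n) ^ 5 / sqrt (real n))"
  have log_top: "filterlim (\<lambda>n. log 2 (real n)) at_top sequentially" by real_asymp
  have "\<forall>\<^sub>F n in sequentially. max (2 * real b) (C + 1) \<le> log 2 (real n)"
    using log_top unfolding filterlim_at_top by blast
  moreover have "\<forall>\<^sub>F n in sequentially. 8 * real d + 4 * (real d * real d) + 4 + 4 * log 2 (real n) \<le> real n"
  proof -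
    have "\<forall>\<^sub>F n in sequentially. K + 4 * log 2 (real n) \<le> real n" for K :: real by real_asymp
    then show ?thesis .
  qed
  moreover have "\<forall>\<^sub>F n in sequentially. d + 2 ^ (10 * b + 1) < n" by (rule eventually_gt_at_top)
  ultimately have "\<forall>\<^sub>F n in sequentially. even (n * d) \<longrightarrow>
    1 - \<epsilon> n \<le> measure_pmf.prob (random_regular_digraph n d) {H. real (oriented_ramsey H) \<le> bound n}"
  proof eventually_elim
    case (elim n)
    have n1: "1 \<le> n" using elim(3) by simp
    \<comment> \<open>The first bound makes t at least 1; the second lets log n absorb C, with 1 to
      spare for rounding.\<close>
    have log1: "2 * real b \<le> log 2 n" "C + 1 \<le> log 2 n" using elim(1) by auto
    define e where "e = nat \<lfloor>log 2 n\<rfloor>"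
    have e: "real e \<le> log 2 n" "log 2 n < e + 1" using log1(2) \<open>C > 0\<close> unfolding e_def by linarith+
    have "2 powr real e \<le> n" using e(1) n1 by (simp add: le_log_iff)
    then have "real (2 ^ e) \<le> real n" by (simp add: powr_realpow)
    then have e2: "2 ^ e \<le> n" by (simp only: of_nat_le_iff)
    have "n < 2 powr real (e + 1)" using e(2) n1 by (simp add: log_less_iff add.commute)
    then have "real n < real (2 ^ (e + 1))" by (simp only: powr_realpow[of 2] zero_less_numeral of_nat_power of_nat_numeral)
    then have e3: "n < 2 ^ (e + 1)" by (simp only: of_nat_less_iff)
    \<comment> \<open>The quotient of the integer part of log n by 2 b places n between the two
      consecutive powers of 2^(2 b) that both first moment bounds use.\<close>
    define t where "t = e div (2 * b)"
    have b0: "2 * b > 0" using assms by (simp add: b_def)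
    have te: "2 * b * t \<le> e" "e + 1 \<le> 2 * b * (t + 1)"
      using dividend_less_times_div[OF b0, of e] by (auto simp: t_def)
    have "2 * b \<le> e" using log1(1) e(2) by linarith
    then have t1: "1 \<le> t" using b0 unfolding t_def by (metis One_nat_def Suc_leI div_greater_zero_iff)
    have "t \<le> e" using te(1) b0 by (metis le_trans mult_le_mono1 nat_mult_1 Suc_leI One_nat_def)
    then have tlog: "real t \<le> log 2 n" using e(1) by linarith
    have p1: "2 ^ (2 * b * t) \<le> n" using e2 te(1) by (meson le_trans one_le_numeral power_increasing)
    have p2: "n < 2 ^ (2 * b * (t + 1))" using e3 te(2) by (meson less_le_trans one_le_numeral power_increasing)
    have tn: "2 ^ t \<le> n" using \<open>t \<le> e\<close> e2 by (meson le_trans one_le_numeral power_increasing)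
    have "real (2 * (4 * d + 2 * (d * d) + 2 * Suc t)) \<le> real n" using elim(2) tlog by simp
    then have "2 * (4 * d + 2 * (d * d) + 2 * Suc t) \<le> n" by (simp only: of_nat_le_iff)
    also have "n \<le> n * d" using assms by simp
    finally have cond: "2 * (4 * d + 2 * (d * d) + 2 * Suc t) \<le> n * d" .
    let ?R = "regular_rels n d"
    define P where "P = (\<lambda>A. peelable d t {1..n} {(x, y) \<in> A. x < y} (\<lambda>x. x div (n div 2 ^ (10 * b + 1) + 1)))"
    have "card {A \<in> ?R. \<not> P A} \<le> (16 * 2 ^ (8 * b) / real n + 2 * real d * real t ^ 5 / sqrt (real n)) * card ?R"
      unfolding P_def by (rule card_not_peelable[OF assms b t1 p1 p2 _ cond]) (use elim(3) in simp)
    also have "\<dots> \<le> \<epsilon> n * card ?R"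
      unfolding \<epsilon>_def using tlog
      by (intro mult_right_mono add_left_mono divide_right_mono mult_left_mono power_mono) auto
    finally have bad: "card {A \<in> ?R. \<not> P A} \<le> \<epsilon> n * card ?R" .
    \<comment> \<open>N must be an integer between \<open>C * n\<close> and \<open>bound n\<close>;
      the extra n gained from C + 1 outweighs the loss in the floor.\<close>
    define N where "N = nat \<lfloor>bound n\<rfloor>"
    have ld: "1 \<le> log 2 (real d)" using assms by (simp add: le_log_iff)
    \<comment> \<open>Since d \<ge> 2, the exponent is at least 4, so the factor on the right is at
      least log n and hence exceeds C.\<close>
    have "log 2 n powr 1 \<le> log 2 n powr (4 * log 2 (real d))"
      using log1(2) \<open>C > 0\<close> ld by (intro powr_mono) auto
    then have "log 2 n \<le> log 2 n powr (4 * log 2 (real d))" using log1(2) \<open>C > 0\<close> by simp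
    then have "C + 1 \<le> log 2 n powr (4 * log 2 (real d))" using log1(2) by linarith
    then have "real n * (C + 1) \<le> bound n" unfolding bound_def by (intro mult_left_mono) auto
    then have "C * n + 1 \<le> bound n" using n1 by (simp add: algebra_simps)
    moreover have "0 \<le> C * n" using \<open>C > 0\<close> by simp
    ultimately have N: "C * n \<le> real N" "real N \<le> bound n" unfolding N_def by linarith+
    show ?case
    proof
      assume ev: "even (n * d)"
      have "d < n" using elim(3) by simp
      then have ne: "?R \<noteq> {}" using ev by (rule regular_rels_nonempty)
      show "1 - \<epsilon> n \<le> measure_pmf.prob (random_regular_digraph n d) {H. real (oriented_ramsey H) \<le> bound n}"
      proof (rule prob_random_regular_digraph_ge[OF ne bad])
        fix A assume "A \<in> ?R" "P A"
        then have "oriented_ramsey (orient_upwards \<lparr>pverts = {1..n}, parcs = A\<rparr>) \<le> N"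
          unfolding P_def by (rule ramsey[OF _ n1 tn _ N(1)])
        then show "orient_upwards \<lparr>pverts = {1..n}, parcs = A\<rparr> \<in> {H. real (oriented_ramsey H) \<le> bound n}"
          using N(2) by simp
      qed
    qed
  qed
  then have lower: "\<forall>\<^sub>F n in inf sequentially (principal {n. even (n * d)}).
    1 - \<epsilon> n \<le> measure_pmf.prob (random_regular_digraph n d) {H. real (oriented_ramsey H) \<le> bound n}"
    by (simp add: eventually_inf_principal)
  have "\<epsilon> \<longlonglongrightarrow> 0"
  proof -
    have 1: "(\<lambda>n. 1 / real n) \<longlonglongrightarrow> 0" and 2: "(\<lambda>n. log 2 (real n) ^ 5 / sqrt (real n)) \<longlonglongrightarrow> 0" by real_asymp+
    show ?thesis
      using tendsto_add[OF tendsto_mult_left[OF 1, of "16 * 2 ^ (8 * b)"] tendsto_mult_left[OF 2, of "2 * real d"]]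
      by (simp add: \<epsilon>_def)
  qed
  then have "(\<lambda>n. 1 - \<epsilon> n) \<longlonglongrightarrow> 1 - 0" by (intro tendsto_diff tendsto_const)
  then have lim: "((\<lambda>n. 1 - \<epsilon> n) \<longlongrightarrow> 1) (inf sequentially (principal {n. even (n * d)}))"
    by (simp add: tendsto_mono[OF inf_le1])
  show ?thesis
    by (rule tendsto_sandwich[OF lower[unfolded bound_def] always_eventually lim tendsto_const])
       (simp add: measure_pmf.prob_le_1)
qed

end
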